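(* Let $\mathfrak{q}=(q_i)_{i\ge 0}$ be a gap sequence such that, for some $q\ge 0$ and $0\le\beta<1$, $Q_k=\sum_{i=0}^{k-1}q_i=qk+O(k^\beta)$ as $k\to\infty$, and let $\gamma\in\bigl(0,\tfrac12(1-\beta)\bigr)$. (a) If $q>0$ then there exists a sequence $(k_n)$ satisfying $k_n\sim T_q\sqrt n/\vartheta_q$ as $n\to\infty$ such that, for any $a>0$, $$\limsup_{n\to\infty} n^{\gamma-1/2}\log\nu_n^{\mathfrak{q}}\bigl\{\lambda\in\Lambda_{\mathfrak{q}}(n)\colon |K(\lambda)-k_n|>a\,n^{(1-\gamma)/2}\bigr\}<0 .$$ (b) If $q=0$ then $$\limsup_{n\to\infty} n^{\gamma-1/2}\log\nu_n^{\mathfrak{q}}\bigl\{\lambda\in\Lambda_{\mathfrak{q}}(n)\colon K(\lambda)<\tfrac12\sqrt n\,\log\log n\ \text{ or }\ K(\lambda)>n^{1-\gamma}\bigr\}<0 .$$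
   Context: A partition is a sequence of integers $\lambda_1\ge\lambda_2\ge\dots\ge0$ with finitely many nonzero terms; $N(\lambda)=\sum_i\lambda_i$ is its weight and $K(\lambda)=\#\{i:\lambda_i>0\}$ its length. A gap sequence $\mathfrak{q}=(q_i)_{i\ge0}$ is a sequence of non-negative integers with $q_0\ge1$. $\Lambda_{\mathfrak{q}}$ is the set of all partitions $\lambda$ such that, with $k=K(\lambda)$, $\lambda_i-\lambda_{i+1}\ge q_{k-i}$ for $i=1,\dots,k$ (the empty partition is included). $\Lambda_{\mathfrak{q}}(n)=\{\lambda\in\Lambda_{\mathfrak{q}}: N(\lambda)=n\}$ and $\nu_n^{\mathfrak{q}}$ is the uniform probability measure on $\Lambda_{\mathfrak{q}}(n)$ (defined whenever this set is non-empty). Convention: $\log 0=-\infty$. For $q>0$, $T_q>0$ is the unique solution of $e^{-qT_q}=1-e^{-T_q}$, and $\vartheta_q>0$ is given by $\vartheta_q^2=\tfrac12 qT_q^2+\mathrm{Li}_2(1-e^{-T_q})$, where $\mathrm{Li}_2(x)=\sum_{k\ge1}x^k/k^2$ for $0\le x\le1$. *)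

theory Defs
  imports
    "HOL-Probability.Probability"
    "HOL-Library.Landau_Symbols"
    "HOL-Library.Extended_Real"
begin

section \<open>Partitions and gap sequences\<close>

text \<open>The parts are indexed from 0, so that \<open>l i\<close> is the part usually written with index \<open>i + 1\<close>.\<close>

definition is_partition :: "(nat \<Rightarrow> nat) \<Rightarrow> bool" where
  "is_partition l \<longleftrightarrow> antimono l \<and> finite {i. l i > 0}"

definition weight :: "(nat \<Rightarrow> nat) \<Rightarrow> nat" where
  "weight l = (\<Sum>i | l i > 0. l i)"

definition num_parts :: "(nat \<Rightarrow> nat) \<Rightarrow> nat" where
  "num_parts l = card {i. l i > 0}"

definition gap_sequence :: "(nat \<Rightarrow> nat) \<Rightarrow> bool" where
  "gap_sequence qs \<longleftrightarrow> qs 0 \<ge> 1"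

text \<open>
  With \<open>k = num_parts l\<close>, the condition between the parts with 1-based indices \<open>i + 1\<close> and \<open>i + 2\<close>
  involves the gap with index \<open>k - (i + 1)\<close>. As \<open>l\<close> is non-increasing, the subtraction of
  parts does not truncate.
\<close>

definition gap_partitions :: "(nat \<Rightarrow> nat) \<Rightarrow> (nat \<Rightarrow> nat) set" where
  "gap_partitions qs = {l. is_partition l \<and>
     (\<forall>i < num_parts l. l i - l (Suc i) \<ge> qs (num_parts l - Suc i))}"

definition gap_partitions_of :: "(nat \<Rightarrow> nat) \<Rightarrow> nat \<Rightarrow> (nat \<Rightarrow> nat) set" where
  "gap_partitions_of qs n = {l \<in> gap_partitions qs. weight l = n}"

lemma is_partition_zero:
  assumes "is_partition l" "weight l \<le> i"
  shows "l i = 0"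
proof (rule ccontr)
  assume "l i \<noteq> 0"
  have *: "l j > 0" if "j \<le> i" for j
    using assms(1) that \<open>l i \<noteq> 0\<close> unfolding is_partition_def antimono_def
    by (metis gr0I le_zero_eq)
  have "Suc i = (\<Sum>j\<le>i. 1)" by simp
  also have "\<dots> \<le> (\<Sum>j\<le>i. l j)"
    using * by (intro sum_mono) (auto simp: Suc_le_eq)
  also have "\<dots> \<le> weight l"
    unfolding weight_def using * assms(1)
    by (intro sum_mono2) (auto simp: is_partition_def)
  finally show False using assms(2) by simp
qed

lemma finite_gap_partitions_of: "finite (gap_partitions_of qs n)"
proof (rule finite_subset)
  show "gap_partitions_of qs n \<subseteq>
      {l. \<forall>i. (i \<in> {..<n} \<longrightarrow> l i \<in> {..n}) \<and> (i \<notin> {..<n} \<longrightarrow> l i = 0)}"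
  proof (clarsimp, intro conjI impI)
    fix l i assume l: "l \<in> gap_partitions_of qs n"
    then have p: "is_partition l" "weight l = n"
      by (auto simp: gap_partitions_of_def gap_partitions_def)
    show "l i \<le> n"
      using p member_le_sum[of i "{i. l i > 0}" l]
      by (cases "l i = 0") (auto simp: weight_def is_partition_def)
    show "l i = 0" if "\<not> i < n"
      using is_partition_zero[OF p(1)] p(2) that by simp
  qed
  show "finite {l :: nat \<Rightarrow> nat. \<forall>i. (i \<in> {..<n} \<longrightarrow> l i \<in> {..n}) \<and> (i \<notin> {..<n} \<longrightarrow> l i = 0)}"
    by (rule finite_set_of_finite_funs) auto
qed

lemma gap_partitions_of_nonempty:
  assumes "gap_sequence qs" "n \<ge> qs 0"
  shows "gap_partitions_of qs n \<noteq> {}"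
proof -
  define l :: "nat \<Rightarrow> nat" where "l = (\<lambda>i. if i = 0 then n else 0)"
  have "{i. l i > 0} = {0}"
    using assms by (auto simp: l_def gap_sequence_def)
  then have "l \<in> gap_partitions_of qs n"
    using assms
    by (auto simp: gap_partitions_of_def gap_partitions_def is_partition_def weight_def
        num_parts_def l_def antimono_def)
  then show ?thesis by blast
qed

text \<open>
  Only meaningful for nonempty \<open>gap_partitions_of qs n\<close>, hence in particular for all
  \<open>n \<ge> qs 0\<close>, by the preceding lemmas.
\<close>

definition gap_measure :: "(nat \<Rightarrow> nat) \<Rightarrow> nat \<Rightarrow> (nat \<Rightarrow> nat) pmf" where
  "gap_measure qs n = pmf_of_set (gap_partitions_of qs n)"

section \<open>Constants and the extended logarithm\<close>

definition T_const :: "real \<Rightarrow> real" where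
  "T_const q = (THE T. T > 0 \<and> exp (- q * T) = 1 - exp (- T))"

lemma T_const_ex1:
  fixes q :: real
  assumes "q > 0"
  shows "\<exists>!T. T > 0 \<and> exp (- q * T) = 1 - exp (- T)"
proof -
  define f where "f = (\<lambda>t :: real. exp (- q * t) + exp (- t))"
  have mono: "f s > f t" if "s < t" for s t
    unfolding f_def using that assms by (intro add_strict_mono) auto
  define b where "b = max (ln 3) (ln 3 / q)"
  have b: "b > 0" "b \<ge> ln 3" "q * b \<ge> ln 3"
    using assms by (auto simp: b_def max_def field_simps)
  have "exp (- q * b) \<le> exp (- ln 3)" "exp (- b) \<le> exp (- ln 3)"
    using b by simp_all
  then have fb: "f b \<le> 1" by (simp add: f_def exp_minus)
  have "\<exists>t\<ge>0. t \<le> b \<and> f t = 1"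
    using b fb by (intro IVT2') (auto simp: f_def intro!: continuous_intros)
  then obtain t where t: "t \<ge> 0" "f t = 1" by blast
  have "t \<noteq> 0" using t by (auto simp: f_def)
  then show ?thesis
    using t mono by (intro ex1I[of _ t]) (auto simp: f_def, smt (verit))
qed

definition Li2 :: "real \<Rightarrow> real" where
  "Li2 x = (\<Sum>k. x ^ Suc k / real (Suc k) ^ 2)"

lemma summable_Li2:
  assumes "0 \<le> x" "x \<le> 1"
  shows "summable (\<lambda>k. x ^ Suc k / real (Suc k) ^ 2)"
proof (rule summable_comparison_test')
  show "summable (\<lambda>k. 1 / real (Suc k) ^ 2)"
    using inverse_power_summable[of 2, where ?'a = real]
    by (subst summable_Suc_iff) (simp add: field_simps)
  show "norm (x ^ Suc k / real (Suc k) ^ 2) \<le> 1 / real (Suc k) ^ 2" if "k \<ge> 0" for k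
    using assms power_le_one[of x "Suc k"] by (simp add: divide_right_mono del: power_Suc)
qed

definition theta_const :: "real \<Rightarrow> real" where
  "theta_const q = sqrt (q * (T_const q)\<^sup>2 / 2 + Li2 (1 - exp (- T_const q)))"

lemma theta_const:
  assumes "q > 0"
  shows "theta_const q > 0"
    and "(theta_const q)\<^sup>2 = q * (T_const q)\<^sup>2 / 2 + Li2 (1 - exp (- T_const q))"
proof -
  have T: "T_const q > 0"
    using theI'[OF T_const_ex1[OF assms]] by (simp add: T_const_def)
  have "Li2 (1 - exp (- T_const q)) \<ge> 0"
    unfolding Li2_def using T by (intro suminf_nonneg summable_Li2) auto
  moreover have "q * (T_const q)\<^sup>2 / 2 > 0" using T assms by simp
  ultimately show "theta_const q > 0"
    "(theta_const q)\<^sup>2 = q * (T_const q)\<^sup>2 / 2 + Li2 (1 - exp (- T_const q))"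
    unfolding theta_const_def by auto
qed

text \<open>The logarithm of a non-negative real, with \<open>log 0 = -\<infinity>\<close> (whereas \<^term>\<open>ln (0::real)\<close> is 0).\<close>

definition ext_ln :: "real \<Rightarrow> ereal" where
  "ext_ln x = (if x = 0 then - \<infinity> else ereal (ln x))"

end

theory Submission
  imports Defs "HOL-Real_Asymp.Real_Asymp"
begin

text \<open>
  Write \<open>s\<^sub>k\<close> for the least weight of a gap partition with \<open>k\<close> parts. Subtracting the least such
  partition turns the gap partitions of \<open>n\<close> with \<open>k\<close> parts into the partitions of \<open>n - s\<^sub>k\<close> into at
  most \<open>k\<close> parts (\<open>card_gap_partitions_with_parts\<close>), so the law of the number of parts is
  proportional to \<open>p\<^sub>k(n - s\<^sub>k)\<close>, where \<open>p\<^sub>k(m)\<close> is \<open>pcount k m\<close>. The growth hypothesis on the gaps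
  enters only through \<open>s\<^sub>k = q k\<^sup>2 / 2 + O(k powr (1 + \<beta>))\<close>. Everything thus reduces to an upper bound on
  \<open>p\<^sub>k(n - s\<^sub>k)\<close> for the unlikely \<open>k\<close> and a lower bound for one good \<open>k\<close>.

  For the upper bound, the generating function gives \<open>p\<^sub>k(m) \<le> exp (t m + log_genfun k t)\<close> for every
  \<open>t > 0\<close>, and \<open>log_genfun k t \<le> Phi (k t) / t\<close>, where \<open>Phi\<close> is the antiderivative of
  \<open>- ln (1 - exp (- x))\<close> that vanishes at 0. Let \<open>q > 0\<close>. The equation that defines \<open>T\<close> says that
  \<open>Phi' T = q T\<close>, and \<open>\<vartheta>\<^sup>2 = Phi T - q T\<^sup>2 / 2\<close>. As \<open>Phi\<close> is concave, it lies below its tangent at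
  \<open>T\<close>, and with \<open>t = \<vartheta> / sqrt n\<close> the exponent is at most
  \<open>2 \<vartheta> sqrt n - (q \<vartheta> / 2) (k - T sqrt n / \<vartheta>)\<^sup>2 / sqrt n + O(n powr (\<beta> / 2))\<close>. A deviation of
  order \<open>n powr ((1 - \<gamma>) / 2)\<close> therefore costs a multiple of \<open>n powr (1/2 - \<gamma>)\<close>, which exceeds the error
  because \<open>\<gamma> < (1 - \<beta>) / 2\<close>. For \<open>q = 0\<close> the limit \<open>P\<close> of \<open>Phi\<close> takes the place of \<open>\<vartheta>\<^sup>2\<close>: a small
  \<open>k\<close> loses \<open>exp (- k t) / t\<close> from \<open>P / t\<close>, and a large \<open>k\<close> loses \<open>t s\<^sub>k \<ge> t k\<close>.

  The lower bound is the harder half. Its error has to be smaller than \<open>n powr (1/2 - \<gamma>)\<close> for \<open>\<gamma>\<close> as close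
  to \<open>1/2\<close> as \<open>\<beta>\<close> permits, so it must not exceed an arbitrarily small power of \<open>n\<close> when \<open>\<beta> = 0\<close>.
  Chernoff bounds show that the weights \<open>p\<^sub>k(z) exp (- t z)\<close> put at least half of their mass on a window of
  width about \<open>m powr (3/4)\<close> just below \<open>m\<close>, for a suitable \<open>t\<close> of order \<open>1 / sqrt m\<close>. Moving from that
  window to \<open>m\<close> by monotonicity of \<open>p\<^sub>k\<close> alone would lose a factor \<open>exp (- m powr (1/4))\<close>. The
  recurrence \<open>m p\<^sub>k(m) = (\<Sum>j\<le>k. \<Sum>r\<ge>1. j p\<^sub>k(m - r j))\<close> does better: below the mean of a tilted law, it
  makes the tilted weight at \<open>m\<close> at least a minimum of earlier tilted weights, so that the distance
  covered costs nothing (\<open>pcount_minimum_principle\<close>). The result is \<open>pcount_lower_bound\<close>. Its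
  exponent \<open>t m + log_genfun k t\<close> is bounded below for all \<open>t\<close> at once, for \<open>q > 0\<close> by the convexity of
  \<open>Phi x / x\<close> (\<open>saddle_exponent_ge\<close>) and for \<open>q = 0\<close> by the
  inequality of arithmetic and geometric means.
\<close>

section \<open>Partitions with a bounded number of parts\<close>

text \<open>
  Partitions of \<open>m\<close> into at most \<open>k\<close> parts, padded by zeros.
\<close>

definition bounded_partitions :: "nat \<Rightarrow> nat \<Rightarrow> (nat \<Rightarrow> nat) set" where
  "bounded_partitions k m = {a. antimono a \<and> (\<forall>i\<ge>k. a i = 0) \<and> (\<Sum>i<k. a i) = m}"

definition pcount :: "nat \<Rightarrow> nat \<Rightarrow> nat" where
  "pcount k m = card (bounded_partitions k m)"

lemma finite_bounded_partitions: "finite (bounded_partitions k m)"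
proof (rule finite_subset)
  show "bounded_partitions k m \<subseteq>
      {l. \<forall>i. (i \<in> {..<k} \<longrightarrow> l i \<in> {..m}) \<and> (i \<notin> {..<k} \<longrightarrow> l i = 0)}"
    by (auto simp: bounded_partitions_def intro!: member_le_sum)
  show "finite {l :: nat \<Rightarrow> nat. \<forall>i. (i \<in> {..<k} \<longrightarrow> l i \<in> {..m}) \<and> (i \<notin> {..<k} \<longrightarrow> l i = 0)}"
    by (rule finite_set_of_finite_funs) auto
qed

lemma pcount_0: "pcount 0 m = (if m = 0 then 1 else 0)"
proof -
  have "bounded_partitions 0 m = (if m = 0 then {\<lambda>_. 0} else {})"
    by (auto simp: bounded_partitions_def antimono_def)
  then show ?thesis by (simp add: pcount_def)
qed

text \<open>
  Either the last of the \<open>k + 1\<close> parts vanishes, or 1 can be subtracted from each of them.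
\<close>

lemma pcount_Suc:
  "pcount (Suc k) m = pcount k m + (if Suc k \<le> m then pcount (Suc k) (m - Suc k) else 0)"
proof -
  let ?A = "bounded_partitions (Suc k) m"
  let ?pos = "{a \<in> ?A. a k > 0}"
  have "card ?A = card {a \<in> ?A. a k = 0} + card ?pos"
    using finite_bounded_partitions
    by (subst card_Un_disjoint [symmetric]) (auto intro!: arg_cong[where f = card] simp: gr0I)
  also have "{a \<in> ?A. a k = 0} = bounded_partitions k m"
    by (auto simp: bounded_partitions_def Suc_le_eq) (metis le_eq_less_or_eq)
  also have "card ?pos = (if Suc k \<le> m then pcount (Suc k) (m - Suc k) else 0)"
  proof (cases "Suc k \<le> m")
    case False
    have "Suc k \<le> m" if a: "a \<in> ?pos" for a
    proof -
      have "antimono a" "a k > 0" using a by (auto simp: bounded_partitions_def)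
      then have "1 \<le> a i" if "i < Suc k" for i
        using that antimonoD[of a i k] by linarith
      then have "(\<Sum>i<Suc k. 1) \<le> (\<Sum>i<Suc k. a i)" by (intro sum_mono) auto
      then show ?thesis using a by (simp add: bounded_partitions_def)
    qed
    then have "?pos = {}" using False by blast
    then have "card ?pos = 0" by (simp only: card.empty)
    then show ?thesis using False by simp
  next
    case True
    define up where "up = (\<lambda>(a :: nat \<Rightarrow> nat) i. if i < Suc k then a i + 1 else 0)"
    define down where "down = (\<lambda>(a :: nat \<Rightarrow> nat) i. a i - 1)"
    have "bij_betw up (bounded_partitions (Suc k) (m - Suc k)) ?pos"
    proof (rule bij_betw_byWitness[where f' = down])
      show "\<forall>a\<in>bounded_partitions (Suc k) (m - Suc k). down (up a) = a"
        by (auto simp: bounded_partitions_def up_def down_def)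
      show "\<forall>a\<in>?pos. up (down a) = a"
      proof
        fix a assume a: "a \<in> ?pos"
        have "a i > 0" if "i < Suc k" for i
          using a that antimonoD[of a i k] by (auto simp: bounded_partitions_def)
        then show "up (down a) = a"
          using a by (force simp: bounded_partitions_def up_def down_def)
      qed
      show "up ` bounded_partitions (Suc k) (m - Suc k) \<subseteq> ?pos"
      proof clarify
        fix a assume a: "a \<in> bounded_partitions (Suc k) (m - Suc k)"
        have "(\<Sum>i<Suc k. up a i) = (\<Sum>i<Suc k. a i) + Suc k"
          using sum.distrib[of a "\<lambda>_. 1" "{..<Suc k}"] by (simp add: up_def del: sum.lessThan_Suc)
        then show "up a \<in> ?A \<and> up a k > 0"
          using a True by (auto simp: bounded_partitions_def antimono_def up_def simp del: sum.lessThan_Suc)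
      qed
      show "down ` ?pos \<subseteq> bounded_partitions (Suc k) (m - Suc k)"
      proof clarify
        fix a assume a: "a \<in> ?A" "a k > 0"
        have "a i > 0" if "i < Suc k" for i
          using a that antimonoD[of a i k] by (auto simp: bounded_partitions_def)
        then have "(\<Sum>i<Suc k. a i) = (\<Sum>i<Suc k. down a i + 1)"
          by (intro sum.cong) (auto simp: down_def)
        then have "(\<Sum>i<Suc k. down a i) = m - Suc k"
          using a sum.distrib[of "down a" "\<lambda>_. 1" "{..<Suc k}"]
          by (simp add: bounded_partitions_def del: sum.lessThan_Suc)
        then show "down a \<in> bounded_partitions (Suc k) (m - Suc k)"
          using a by (auto simp: bounded_partitions_def antimono_def down_def
              intro!: diff_le_mono simp del: sum.lessThan_Suc)
      qed
    qed
    then show ?thesis using True by (simp add: pcount_def bij_betw_same_card)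
  qed
  finally show ?thesis by (simp add: pcount_def)
qed

lemma pcount_mono:
  assumes "k > 0" "m \<le> m'"
  shows "pcount k m \<le> pcount k m'"
proof -
  have "pcount (Suc k) m \<le> pcount (Suc k) (Suc m)" for k m
  proof (induction k arbitrary: m)
    case 0
    have "pcount 1 m = 1" for m by (induction m) (simp_all add: pcount_Suc[of 0] pcount_0)
    then show ?case by simp
  next
    case (Suc k)
    show ?case
    proof (induction m rule: less_induct)
      case (less m)
      let ?K = "Suc (Suc k)"
      have "(if ?K \<le> m then pcount ?K (m - ?K) else 0)
          \<le> (if ?K \<le> Suc m then pcount ?K (Suc m - ?K) else 0)"
        using less[of "m - ?K"] Suc_diff_le[of ?K m] by (cases "?K \<le> m") auto
      then show ?case
        using Suc.IH[of m] pcount_Suc[of "Suc k" m] pcount_Suc[of "Suc k" "Suc m"] by linarith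
    qed
  qed
  then have "pcount k m \<le> pcount k (Suc m)" for m
    using assms(1) by (cases k) auto
  then show ?thesis using assms(2) lift_Suc_mono_le[of "pcount k"] by blast
qed

text \<open>
  Extending the count by 0 to negative weights keeps truncated subtraction out of the recurrences.
\<close>

definition pcount_int :: "nat \<Rightarrow> int \<Rightarrow> real" where
  "pcount_int k m = (if m < 0 then 0 else real (pcount k (nat m)))"

lemma pcount_int_Suc: "pcount_int (Suc k) m = pcount_int k m + pcount_int (Suc k) (m - int (Suc k))"
proof (cases "m < 0")
  case False
  then have "nat (m - int (Suc k)) = nat m - Suc k" by simp
  then show ?thesis using False pcount_Suc[of k "nat m"] by (auto simp: pcount_int_def)
qed (auto simp: pcount_int_def)

text \<open>
  \<^const>\<open>pcount\<close> also counts partitions into parts of size at most \<open>k + 1\<close>; here \<open>r\<close> is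
  the number of parts of size \<open>k + 1\<close>.
\<close>

lemma pcount_int_unfold:
  assumes "m < int N"
  shows "(\<Sum>r<N. pcount_int k (m - int (r * Suc k))) = pcount_int (Suc k) m"
  using assms
proof (induction N arbitrary: m)
  case 0
  then show ?case by (simp add: pcount_int_def)
next
  case (Suc N)
  have "(\<Sum>r<Suc N. pcount_int k (m - int (r * Suc k)))
      = pcount_int k m + (\<Sum>r<N. pcount_int k ((m - int (Suc k)) - int (r * Suc k)))"
    by (subst sum.lessThan_Suc_shift) (simp add: algebra_simps)
  also have "\<dots> = pcount_int (Suc k) m"
    using Suc.IH[of "m - int (Suc k)"] Suc.prems by (simp only: pcount_int_Suc[of k m])
  finally show ?case .
qed

text \<open>
  This is the coefficient form of \<open>X F' = F (\<Sum>j\<le>k. j X\<^sup>j / (1 - X\<^sup>j))\<close> for the generating function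
  \<open>F = (\<Prod>j\<le>k. 1 / (1 - X\<^sup>j))\<close>. The induction on \<open>k\<close> and \<open>m\<close> rests on
  \<open>pcount_int_Suc\<close>, applied to every term. The bound \<open>N\<close> is large enough for all
  terms with \<open>r > N\<close> to vanish.
\<close>

lemma pcount_recurrence:
  assumes "m < int N"
  shows "real_of_int m * pcount_int k m = (\<Sum>j=1..k. \<Sum>r=1..N. real j * pcount_int k (m - int (r * j)))"
  using assms
proof (induction k arbitrary: m)
  case 0
  then show ?case by (auto simp: pcount_int_def pcount_0)
next
  case (Suc k)
  define S where "S = (\<lambda>k m. \<Sum>j=1..k. \<Sum>r=1..N. real j * pcount_int k (m - int (r * j)))"
  have "real_of_int m * pcount_int (Suc k) m = S (Suc k) m" if "m < int N" for m
    using that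
  proof (induction "nat m" arbitrary: m rule: less_induct)
    case less
    show ?case
    proof (cases "m < 0")
      case True
      then have "m - int (r * j) < 0" for r j
        using True of_nat_0_le_iff[of "r * j"] by linarith
      then have "S (Suc k) m = 0" unfolding S_def by (intro sum.neutral ballI) (simp only: pcount_int_def if_True mult_zero_right)
      then show ?thesis using True by (simp add: pcount_int_def)
    next
      case False
      let ?m' = "m - int (Suc k)"
      have *: "pcount_int (Suc k) (m - int (r * j)) = pcount_int k (m - int (r * j)) + pcount_int (Suc k) (?m' - int (r * j))" for r j
        by (subst pcount_int_Suc) (simp add: algebra_simps)
      have "S (Suc k) m = (\<Sum>j=1..Suc k. \<Sum>r=1..N. real j * pcount_int k (m - int (r * j))) + S (Suc k) ?m'"
        unfolding S_def by (subst *) (simp add: algebra_simps sum.distrib del: sum.cl_ivl_Suc of_nat_Suc)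
      also have "(\<Sum>j=1..Suc k. \<Sum>r=1..N. real j * pcount_int k (m - int (r * j)))
          = S k m + real (Suc k) * (\<Sum>r=1..N. pcount_int k (m - int (r * Suc k)))"
        by (simp only: S_def sum_distrib_left sum.cl_ivl_Suc if_True le_add1 plus_1_eq_Suc) simp_all
      also have "(\<Sum>r=1..N. pcount_int k (m - int (r * Suc k))) = (\<Sum>r<N. pcount_int k (?m' - int (r * Suc k)))"
        by (simp add: sum.atLeast1_atMost_eq algebra_simps)
      also have "\<dots> = pcount_int (Suc k) ?m'"
        using less.prems by (intro pcount_int_unfold) auto
      also have "S (Suc k) ?m' = real_of_int ?m' * pcount_int (Suc k) ?m'"
      proof -
        have "nat ?m' < nat m \<or> m = 0" using False by linarith
        moreover have "S (Suc k) ?m' = real_of_int ?m' * pcount_int (Suc k) ?m'" if "m = 0"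
        proof -
          have "?m' - int (r * j) < 0" for r j
            using that of_nat_0_le_iff[of "r * j"] of_nat_0_le_iff[of k] by linarith
          then have "S (Suc k) ?m' = 0" unfolding S_def by (intro sum.neutral ballI) (simp only: pcount_int_def if_True mult_zero_right)
          then show ?thesis using that by (simp add: pcount_int_def)
        qed
        moreover have "S (Suc k) ?m' = real_of_int ?m' * pcount_int (Suc k) ?m'" if "nat ?m' < nat m"
          using less.hyps[of ?m'] that less.prems by simp
        ultimately show ?thesis by blast
      qed
      also have "S k m = real_of_int m * pcount_int k m"
        using Suc.IH[of m] less.prems by (simp add: S_def)
      finally show ?thesis
        by (simp add: pcount_int_Suc[of k m] algebra_simps)
    qed
  qed
  then show ?case using Suc.prems by (simp add: S_def)
qed

section \<open>The generating function and exponential tilting\<close>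

text \<open>
  The logarithm of \<open>\<Sum>m. pcount k m * exp (- t m)\<close>, see \<open>pcount_gen_sums\<close> below.
\<close>

definition log_genfun :: "nat \<Rightarrow> real \<Rightarrow> real" where
  "log_genfun k t = (\<Sum>j=1..k. - ln (1 - exp (- (t * real j))))"

text \<open>
  The mean of the probability law on weights \<open>m\<close> that is proportional to \<open>pcount k m * exp (- t m)\<close>.
  It is minus the derivative of \<^const>\<open>log_genfun\<close>, a fact used in the form of
  \<open>log_genfun_diff\<close> below.
\<close>

definition tilted_mean :: "nat \<Rightarrow> real \<Rightarrow> real" where
  "tilted_mean k t = (\<Sum>j=1..k. real j / (exp (t * real j) - 1))"

text \<open>
  The recurrence \<open>pcount_Suc\<close> says that the sum \<open>G\<close> for \<open>k + 1\<close> satisfies \<open>G = F + y G\<close> with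
  \<open>y = exp (- t (k + 1))\<close>, where \<open>F\<close> is the sum for \<open>k\<close>. Applied to partial sums, it also gives convergence.
\<close>

lemma pcount_gen_sums:
  assumes "t > 0"
  shows "(\<lambda>m. real (pcount k m) * exp (- (t * real m))) sums exp (log_genfun k t)"
proof (induction k)
  case 0
  have "(\<lambda>m. real (pcount 0 m) * exp (- (t * real m))) = (\<lambda>m. if m = 0 then 1 else 0)"
    by (auto simp: pcount_0)
  then show ?case using sums_single[of 0 "\<lambda>_. 1 :: real"] by (simp add: log_genfun_def)
next
  case (Suc k)
  define f where "f = (\<lambda>m. real (pcount k m) * exp (- (t * real m)))"
  define g where "g = (\<lambda>m. real (pcount (Suc k) m) * exp (- (t * real m)))"
  define y where "y = exp (- (t * real (Suc k)))"
  define h where "h = (\<lambda>m. if Suc k \<le> m then y * g (m - Suc k) else 0)"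
  define F where "F = exp (log_genfun k t)"
  have y: "0 < y" "y < 1" using assms by (auto simp: y_def)
  have fF: "f sums F" using Suc by (simp add: f_def F_def)
  have nonneg: "f m \<ge> 0" "g m \<ge> 0" "h m \<ge> 0" for m using y by (auto simp: f_def g_def h_def)
  have gfh: "g m = f m + h m" for m
  proof (cases "Suc k \<le> m")
    case True
    then have "exp (- (t * real m)) = y * exp (- (t * real (m - Suc k)))"
      by (simp add: y_def of_nat_diff algebra_simps flip: exp_add)
    then show ?thesis using True pcount_Suc[of k m]
      by (simp add: f_def g_def h_def algebra_simps)
  qed (use pcount_Suc[of k m] in \<open>simp add: f_def g_def h_def\<close>)
  have bd: "(\<Sum>m<N. g m) \<le> F / (1 - y)" for N
  proof -
    have "(\<Sum>m<N. h m) \<le> (\<Sum>m<N + Suc k. h m)"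
      using nonneg by (intro sum_mono2) auto
    also have "\<dots> = (\<Sum>m<N. y * g m)"
    proof -
      have "(\<Sum>m<N + Suc k. h m) = (\<Sum>m\<in>{Suc k..<N + Suc k}. h m)"
        by (intro sum.mono_neutral_right) (auto simp: h_def)
      also have "\<dots> = (\<Sum>m\<in>{0..<N}. h (m + Suc k))"
        using sum.shift_bounds_nat_ivl[of h 0 "Suc k" N] by simp
      finally show ?thesis by (simp add: h_def lessThan_atLeast0)
    qed
    also have "\<dots> = y * (\<Sum>m<N. g m)" by (simp add: sum_distrib_left)
    finally have "(\<Sum>m<N. g m) \<le> (\<Sum>m<N. f m) + y * (\<Sum>m<N. g m)"
      by (simp add: gfh sum.distrib)
    moreover have "(\<Sum>m<N. f m) \<le> F"
      using fF nonneg(1) by (metis sum_le_suminf sums_iff finite_lessThan)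
    ultimately show ?thesis using y by (simp add: field_simps)
  qed
  have "summable g"
    using nonneg bd by (intro summableI_nonneg_bounded)
  then obtain G where G: "g sums G" by (auto simp: summable_def)
  have "(\<lambda>m. h (m + Suc k)) sums (y * G)"
    using sums_mult[OF G, of y] by (simp add: h_def)
  then have "h sums (y * G + (\<Sum>m<Suc k. h m))" by (simp only: sums_iff_shift)
  moreover have "(\<Sum>m<Suc k. h m) = 0" by (intro sum.neutral) (auto simp: h_def)
  ultimately have "h sums (y * G)" by simp
  from sums_add[OF fF this] have "g sums (F + y * G)" by (simp flip: gfh)
  with G have "G = F + y * G" by (rule sums_unique2)
  then have "G = F / (1 - y)" using y by (simp add: field_simps)
  also have "\<dots> = exp (log_genfun (Suc k) t)"
    using y by (simp add: F_def log_genfun_def exp_diff y_def)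
  finally show ?case using G by (simp add: g_def)
qed

lemma pcount_upper:
  assumes "t > 0"
  shows "real (pcount k m) \<le> exp (t * real m + log_genfun k t)"
proof -
  have "(\<Sum>i\<in>{m}. real (pcount k i) * exp (- (t * real i))) \<le> exp (log_genfun k t)"
    using pcount_gen_sums[OF assms, of k]
    by (subst sums_unique, assumption, intro sum_le_suminf) (auto simp: sums_iff)
  then show ?thesis by (simp add: exp_add exp_minus field_simps)
qed

text \<open>
  Let \<open>u m = pcount k m * exp (- t m)\<close>. The recurrence reads
  \<open>m * u m = (\<Sum>j. \<Sum>r. j * exp (- t r j) * u (m - r j))\<close>. The hypothesis says that the weights with
  \<open>r j \<le> L\<close> alone sum to at least \<open>m\<close>, so \<open>u m\<close> is at least the minimum of \<open>u\<close> over the \<open>L\<close>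
  preceding points. By induction \<open>u m\<close> is at least the minimum of \<open>u\<close> over \<open>{z..z + L}\<close>, and there
  monotonicity of \<^const>\<open>pcount\<close> gives \<open>exp (- t L) * u z\<close>. The loss \<open>t L\<close> does not
  depend on the distance between \<open>z\<close> and \<open>m\<close>.
\<close>

lemma pcount_minimum_principle:
  assumes k: "k > 0" and t: "t > 0" and zm: "z \<le> m"
    and m: "real m \<le> (\<Sum>j=1..k. \<Sum>r=1..L div j. real j * exp (- (t * real (r * j))))"
  shows "real (pcount k m) \<ge> exp (t * (real m - real z) - t * real L) * real (pcount k z)"
proof -
  have "exp (t * (real m' - real z) - t * real L) * real (pcount k z) \<le> real (pcount k m')"
    if "z \<le> m'" "m' \<le> m" for m'
    using that
  proof (induction m' rule: less_induct)
    case (less m')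
    show ?case
    proof (cases "m' \<le> z + L")
      case True
      then have "real m' - real z \<le> real L" by simp
      then have "t * (real m' - real z) \<le> t * real L"
        using t by (intro mult_left_mono) auto
      then have "exp (t * (real m' - real z) - t * real L) * real (pcount k z) \<le> 1 * real (pcount k z)"
        by (intro mult_right_mono) auto
      also have "\<dots> \<le> real (pcount k m')" using pcount_mono[OF k less.prems(1)] by simp
      finally show ?thesis .
    next
      case False
      define w where "w = exp (t * (real m' - real z) - t * real L) * real (pcount k z)"
      have w: "w \<ge> 0" by (simp add: w_def)
      define N where "N = m' + L + 1"
      have "w * real m' \<le> w * (\<Sum>j=1..k. \<Sum>r=1..L div j. real j * exp (- (t * real (r * j))))"
        using w m less.prems by (intro mult_left_mono) auto
      also have "\<dots> = (\<Sum>j=1..k. \<Sum>r=1..L div j. real j * (w * exp (- (t * real (r * j)))))"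
        by (simp add: sum_distrib_left mult_ac)
      also have "\<dots> \<le> (\<Sum>j=1..k. \<Sum>r=1..L div j. real j * pcount_int k (int m' - int (r * j)))"
      proof (intro sum_mono mult_left_mono)
        fix j r assume j: "j \<in> {1..k}" and r: "r \<in> {1..L div j}"
        have "r * j \<le> (L div j) * j" using r by (intro mult_right_mono) auto
        also have "\<dots> \<le> L" by simp
        finally have rj: "r * j \<le> L" .
        have rj0: "r * j > 0" using j r by auto
        define m'' where "m'' = m' - r * j"
        have m'': "z \<le> m''" "m'' < m'" "m'' \<le> m" "int m' - int (r * j) = int m''" "real m'' = real m' - real (r * j)"
          using rj rj0 False less.prems by (auto simp: m''_def of_nat_diff)
        have "w * exp (- (t * real (r * j))) = exp (t * (real m'' - real z) - t * real L) * real (pcount k z)"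
          unfolding w_def m''(5) by (simp add: algebra_simps flip: exp_add)
        also have "\<dots> \<le> real (pcount k m'')" by (rule less.IH) (use m'' in auto)
        finally show "w * exp (- (t * real (r * j))) \<le> pcount_int k (int m' - int (r * j))"
          unfolding m''(4) by (simp add: pcount_int_def)
      qed auto
      also have "\<dots> \<le> (\<Sum>j=1..k. \<Sum>r=1..N. real j * pcount_int k (int m' - int (r * j)))"
      proof (intro sum_mono sum_mono2)
        fix j assume "j \<in> {1..k}"
        have "L div j \<le> N" by (rule order_trans[OF div_le_dividend]) (simp add: N_def)
        then show "{1..L div j} \<subseteq> {1..N}" by simp
      qed (auto simp: pcount_int_def)
      also have "\<dots> = real_of_int (int m') * pcount_int k (int m')"
        by (rule pcount_recurrence[symmetric]) (simp add: N_def)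
      also have "\<dots> = real (pcount k m') * real m'" by (simp add: pcount_int_def)
      finally have "w * real m' \<le> real (pcount k m') * real m'" .
      moreover have "real m' > 0" using False by simp
      ultimately show ?thesis by (simp add: w_def)
    qed
  qed
  then show ?thesis using zm by blast
qed

text \<open>
  The sum of all the weights \<open>j * exp (- t r j)\<close> is the mean of the tilted law, because
  \<open>(\<Sum>r\<ge>1. exp (- t r j)) = 1 / (exp (t j) - 1)\<close>. Cutting the geometric series at \<open>r j \<le> L\<close> removes
  at most the fraction \<open>exp (- t (L - k))\<close>.
\<close>

lemma tilted_mean_truncated:
  assumes t: "t > 0"
  shows "(1 - exp (- (t * (real L - real k)))) * tilted_mean k t
     \<le> (\<Sum>j=1..k. \<Sum>r=1..L div j. real j * exp (- (t * real (r * j))))"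
  unfolding tilted_mean_def sum_distrib_left
proof (rule sum_mono)
  fix j assume j: "j \<in> {1..k}"
  define x where "x = exp (- (t * real j))"
  define R where "R = L div j"
  have x: "0 < x" "x < 1" using t j by (auto simp: x_def)
  have "(\<Sum>r=1..R. x ^ r) = (\<Sum>r<R. x * x ^ r)"
    by (rule sum.reindex_bij_witness[where i = Suc and j = "\<lambda>r. r - 1"])
       (auto simp: power_eq_if)
  also have "\<dots> = x * (\<Sum>r<R. x ^ r)" by (simp add: sum_distrib_left)
  also have "\<dots> = x * ((1 - x ^ R) / (1 - x))" using x by (subst sum_gp_strict) auto
  finally have geo: "(\<Sum>r=1..R. x ^ r) = x * ((1 - x ^ R) / (1 - x))" .
  have pw: "exp (- (t * real (r * j))) = x ^ r" for r
    unfolding x_def by (simp flip: exp_of_nat_mult)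
  have "L = R * j + L mod j" by (simp add: R_def)
  moreover have "L mod j < j" using j by simp
  moreover have "j \<le> k" using j by simp
  ultimately have "real L - real k \<le> real (R * j)" by linarith
  then have "exp (- (t * real (R * j))) \<le> exp (- (t * (real L - real k)))"
    using t by simp
  then have "(1 - exp (- (t * (real L - real k)))) * (real j / (exp (t * real j) - 1))
      \<le> (1 - x ^ R) * (real j / (exp (t * real j) - 1))"
    using t by (intro mult_right_mono) (auto simp flip: pw)
  also have "\<dots> = real j * (x * ((1 - x ^ R) / (1 - x)))"
  proof -
    have e: "exp (t * real j) = 1 / x" by (simp add: x_def exp_minus field_simps)
    show ?thesis unfolding e using x by (simp add: field_simps)
  qed
  also have "\<dots> = (\<Sum>r=1..L div j. real j * exp (- (t * real (r * j))))"
    by (simp only: geo[symmetric] R_def[symmetric] pw sum_distrib_left)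
  finally show "(1 - exp (- (t * (real L - real k)))) * (real j / (exp (t * real j) - 1))
     \<le> (\<Sum>r=1..L div j. real j * exp (- (t * real (r * j))))" .
qed

section \<open>Removing the minimal gap partition\<close>

definition gap_sum :: "(nat \<Rightarrow> nat) \<Rightarrow> nat \<Rightarrow> nat" where
  "gap_sum qs j = (\<Sum>i<j. qs i)"

definition min_weight :: "(nat \<Rightarrow> nat) \<Rightarrow> nat \<Rightarrow> nat" where
  "min_weight qs k = (\<Sum>j=1..k. gap_sum qs j)"

lemma gap_sum_mono: "i \<le> j \<Longrightarrow> gap_sum qs i \<le> gap_sum qs j"
  unfolding gap_sum_def by (intro sum_mono2) auto

lemma min_weight_alt: "(\<Sum>i<k. gap_sum qs (k - i)) = min_weight qs k"
  unfolding min_weight_def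
  by (rule sum.reindex_bij_witness[where i = "\<lambda>j. k - j" and j = "\<lambda>i. k - i"]) auto

lemma partition_support:
  assumes "is_partition l"
  shows "l i > 0 \<longleftrightarrow> i < num_parts l"
proof -
  define S where "S = {i. l i > 0}"
  have "finite S" using assms by (simp add: S_def is_partition_def)
  have down: "i \<in> S" if "j \<in> S" "i \<le> j" for i j
    using assms that antimonoD[of l i j] by (simp add: S_def is_partition_def)
  have "\<exists>M. S = {..<M}"
  proof (cases "S = {}")
    case False
    then have Max: "Max S \<in> S" using \<open>finite S\<close> by simp
    have "S = {..<Suc (Max S)}"
    proof (rule set_eqI)
      fix i
      show "i \<in> S \<longleftrightarrow> i \<in> {..<Suc (Max S)}"
        using down[OF Max, of i] Max_ge[OF \<open>finite S\<close>, of i] by auto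
    qed
    then show ?thesis by (rule exI)
  qed auto
  then obtain M where "S = {..<M}" by blast
  then show ?thesis by (auto simp: S_def num_parts_def)
qed

text \<open>
  In a gap partition with \<open>k\<close> parts, the part with index \<open>i\<close> is at least \<open>gap_sum qs (k - i)\<close>. As
  the difference of consecutive bounds is exactly the required gap, subtracting these bounds turns the gap
  condition into monotonicity. For \<open>i \<ge> k\<close> the bound is \<open>gap_sum qs 0 = 0\<close>.
\<close>

lemma gap_partitions_with_parts:
  assumes "gap_sequence qs"
  shows "{l \<in> gap_partitions_of qs n. num_parts l = k} =
    (if min_weight qs k \<le> n
     then (\<lambda>a i. a i + gap_sum qs (k - i)) ` bounded_partitions k (n - min_weight qs k) else {})"
    (is "?L = ?R")
proof
  let ?Q = "gap_sum qs"
  have Qstep: "?Q (k - i) = ?Q (k - Suc i) + qs (k - Suc i)" if "i < k" for i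
    using that by (simp add: gap_sum_def flip: Suc_diff_Suc)
  have Qpos: "?Q (k - i) > 0" if "i < k" for i
  proof -
    have "qs 0 \<le> ?Q (k - i)" unfolding gap_sum_def
      using that by (intro member_le_sum) auto
    then show ?thesis using assms by (simp add: gap_sequence_def)
  qed
  show "?R \<subseteq> ?L"
  proof (cases "min_weight qs k \<le> n")
    case True
    have "(\<lambda>i. a i + ?Q (k - i)) \<in> ?L" if a: "a \<in> bounded_partitions k (n - min_weight qs k)" for a
    proof -
      let ?l = "\<lambda>i. a i + ?Q (k - i)"
      have a': "antimono a" "\<And>i. i \<ge> k \<Longrightarrow> a i = 0" "(\<Sum>i<k. a i) = n - min_weight qs k"
        using a by (auto simp: bounded_partitions_def)
      have supp: "{i. ?l i > 0} = {..<k}"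
      proof -
        have "?l i > 0 \<longleftrightarrow> i < k" for i
          using a'(2)[of i] Qpos[of i] by (cases "i < k") (auto simp: gap_sum_def)
        then show ?thesis by (intro set_eqI) (simp only: mem_Collect_eq lessThan_iff)
      qed
      have "antimono ?l"
      proof (rule antimonoI)
        fix i j :: nat assume "i \<le> j"
        then have "a j \<le> a i" "?Q (k - j) \<le> ?Q (k - i)"
          using antimonoD[OF a'(1)] by (auto intro!: gap_sum_mono)
        then show "?l j \<le> ?l i" by simp
      qed
      then have "is_partition ?l" using supp by (simp add: is_partition_def)
      moreover have "num_parts ?l = k" using supp by (simp add: num_parts_def)
      moreover have "weight ?l = n"
        using supp a'(3) True by (simp add: weight_def sum.distrib min_weight_alt)
      moreover have "?l i - ?l (Suc i) \<ge> qs (k - Suc i)" if "i < k" for i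
        using Qstep[OF that] antimonoD[OF a'(1), of i "Suc i"] by simp
      ultimately show ?thesis by (simp add: gap_partitions_of_def gap_partitions_def)
    qed
    then show ?thesis using True by auto
  qed auto
  show "?L \<subseteq> ?R"
  proof
    fix l assume "l \<in> ?L"
    then have l: "is_partition l" "weight l = n" "num_parts l = k"
      and gap: "\<And>i. i < k \<Longrightarrow> qs (k - Suc i) \<le> l i - l (Suc i)"
      by (auto simp: gap_partitions_of_def gap_partitions_def)
    have supp: "l i > 0 \<longleftrightarrow> i < k" for i using partition_support[OF l(1)] l(3) by simp
    have anti: "antimono l" using l(1) by (simp add: is_partition_def)
    have lsum: "(\<Sum>i<k. l i) = n" using l(2) supp by (simp add: weight_def lessThan_def)
    have gap': "l i \<ge> l (Suc i) + qs (k - Suc i)" if "i < k" for i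
      using gap[OF that] antimonoD[OF anti, of i "Suc i"] by simp
    have ge: "l i \<ge> ?Q (k - i)" for i
    proof (cases "i \<le> k")
      case True
      then show ?thesis
      proof (induction i rule: inc_induct)
        case base
        then show ?case by (simp add: gap_sum_def)
      next
        case (step i)
        then show ?case using gap'[of i] Qstep[of i] by simp
      qed
    qed (simp add: gap_sum_def)
    define a where "a = (\<lambda>i. l i - ?Q (k - i))"
    have la: "l = (\<lambda>i. a i + ?Q (k - i))" using ge by (auto simp: a_def)
    have "a (Suc i) \<le> a i" for i
    proof (cases "i < k")
      case True
      then show ?thesis using gap'[OF True] Qstep[OF True] ge[of i] ge[of "Suc i"]
        unfolding a_def by linarith
    next
      case False
      then show ?thesis using supp[of "Suc i"] by (simp add: a_def)
    qed
    then have "antimono a" by (simp add: antimono_iff_le_Suc)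
    moreover have "a i = 0" if "i \<ge> k" for i using supp[of i] that by (simp add: a_def)
    moreover have asum: "(\<Sum>i<k. a i) + min_weight qs k = n"
      using lsum by (subst (asm) la) (simp add: sum.distrib min_weight_alt)
    ultimately have "a \<in> bounded_partitions k (n - min_weight qs k)"
      by (auto simp: bounded_partitions_def)
    moreover have "min_weight qs k \<le> n" using asum by simp
    ultimately show "l \<in> ?R" using la by auto
  qed
qed

lemma card_gap_partitions_with_parts:
  assumes "gap_sequence qs"
  shows "card {l \<in> gap_partitions_of qs n. num_parts l = k} =
    (if min_weight qs k \<le> n then pcount k (n - min_weight qs k) else 0)"
proof -
  have "inj_on (\<lambda>a i. a i + gap_sum qs (k - i)) (bounded_partitions k m)" for m
    by (rule inj_onI) (auto simp: fun_eq_iff)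
  then show ?thesis
    by (simp add: gap_partitions_with_parts[OF assms] card_image pcount_def)
qed

section \<open>A lower bound for the number of bounded partitions\<close>

lemma exp_recip_diff_lower:
  fixes a b :: real
  assumes "0 < a" "a \<le> b"
  shows "(b - a) * exp (- b) \<le> 1 / (exp a - 1) - 1 / (exp b - 1)"
proof -
  have ab: "exp a > 1" "exp b > 1" "exp a \<le> exp b" using assms by auto
  have "(b - a) * exp (- b) \<le> (exp (b - a) - 1) * exp (- b)"
    using exp_ge_add_one_self[of "b - a"] by (intro mult_right_mono) (linarith, simp)
  also have "\<dots> = (exp b - exp a) / (exp a * exp b)"
    by (simp add: exp_diff exp_minus field_simps)
  also have "\<dots> \<le> (exp b - exp a) / ((exp a - 1) * (exp b - 1))"
    using ab by (intro divide_left_mono mult_mono mult_pos_pos) auto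
  also have "\<dots> = 1 / (exp a - 1) - 1 / (exp b - 1)"
    using ab by (simp add: field_simps)
  finally show ?thesis .
qed

lemma exp_recip_diff_upper:
  fixes a b :: real
  assumes "0 < a" "a \<le> b"
  shows "1 / (exp a - 1) - 1 / (exp b - 1) \<le> (b - a) * ((1 + a) / a\<^sup>2)"
proof -
  have ab: "exp a > 1" "exp b > 1" "exp a \<le> exp b" using assms by auto
  have ge: "exp a - 1 \<ge> a" "exp b - 1 \<ge> b"
    using exp_ge_add_one_self[of a] exp_ge_add_one_self[of b] by linarith+
  have "exp b * (1 - exp (- (b - a))) \<le> exp b * (b - a)"
    using exp_ge_add_one_self[of "- (b - a)"] by (intro mult_left_mono) (linarith, simp)
  moreover have "exp b * exp (- (b - a)) = exp a" by (simp add: mult_exp_exp)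
  ultimately have 1: "exp b - exp a \<le> (b - a) * exp b"
    by (simp add: algebra_simps)
  have "exp b / (exp b - 1) = 1 + 1 / (exp b - 1)" using ab by (simp add: field_simps)
  also have "\<dots> \<le> 1 + 1 / a" using ge assms by (intro add_left_mono divide_left_mono mult_pos_pos) auto
  finally have 2: "exp b / (exp b - 1) \<le> 1 + 1 / a" .
  have "1 / (exp a - 1) - 1 / (exp b - 1) = (exp b - exp a) / ((exp a - 1) * (exp b - 1))"
    using ab by (simp add: field_simps)
  also have "\<dots> \<le> ((b - a) * exp b) / ((exp a - 1) * (exp b - 1))"
    using ab 1 by (intro divide_right_mono mult_nonneg_nonneg) auto
  also have "\<dots> = (b - a) * (1 / (exp a - 1)) * (exp b / (exp b - 1))" by simp
  also have "\<dots> \<le> (b - a) * (1 / a) * (1 + 1 / a)"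
    using assms ge ab 2 by (intro mult_mono divide_left_mono mult_pos_pos mult_nonneg_nonneg) auto
  also have "\<dots> = (b - a) * ((1 + a) / a\<^sup>2)"
    using assms by (simp add: field_simps power2_eq_square)
  finally show ?thesis .
qed

text \<open>
  This lemma and \<open>tilted_mean_diff_upper\<close> play the part of bounds on the variance of the tilted law, which is
  minus the derivative of its mean.
\<close>

lemma tilted_mean_diff_lower:
  assumes "0 < s" "s \<le> s'"
  shows "(s' - s) * (\<Sum>j=1..k. (real j)\<^sup>2 * exp (- (s' * real j))) \<le> tilted_mean k s - tilted_mean k s'"
proof -
  have "(s' - s) * (\<Sum>j=1..k. (real j)\<^sup>2 * exp (- (s' * real j)))
      = (\<Sum>j=1..k. real j * ((s' * real j - s * real j) * exp (- (s' * real j))))"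
    by (simp add: sum_distrib_left power2_eq_square algebra_simps)
  also have "\<dots> \<le> (\<Sum>j=1..k. real j * (1 / (exp (s * real j) - 1) - 1 / (exp (s' * real j) - 1)))"
    using assms by (intro sum_mono mult_left_mono exp_recip_diff_lower mult_right_mono) auto
  also have "\<dots> = tilted_mean k s - tilted_mean k s'" by (simp add: tilted_mean_def sum_subtractf algebra_simps)
  finally show ?thesis .
qed

lemma tilted_mean_diff_upper:
  assumes "0 < s" "s \<le> s'"
  shows "tilted_mean k s - tilted_mean k s' \<le> (s' - s) * (real k * (1 + s * real k) / s\<^sup>2)"
proof -
  have "tilted_mean k s - tilted_mean k s' = (\<Sum>j=1..k. real j * (1 / (exp (s * real j) - 1) - 1 / (exp (s' * real j) - 1)))"
    by (simp add: tilted_mean_def sum_subtractf algebra_simps)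
  also have "\<dots> \<le> (\<Sum>j=1..k. real j * ((s' * real j - s * real j) * ((1 + s * real j) / (s * real j)\<^sup>2)))"
    using assms by (intro sum_mono mult_left_mono exp_recip_diff_upper mult_right_mono) auto
  also have "\<dots> = (\<Sum>j=1..k. (s' - s) * ((1 + s * real j) / s\<^sup>2))"
    using assms by (intro sum.cong) (auto simp: field_simps power2_eq_square)
  also have "\<dots> \<le> (\<Sum>j=1..k. (s' - s) * ((1 + s * real k) / s\<^sup>2))"
    using assms by (intro sum_mono mult_left_mono divide_right_mono) auto
  also have "\<dots> = (s' - s) * (real k * (1 + s * real k) / s\<^sup>2)" by simp
  finally show ?thesis .
qed

text \<open>
  With \<open>y = t j\<close>, the term \<open>y / (exp y - 1)\<close> is at most \<open>2 * exp (- y / 2)\<close>, and a geometric series remains.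
\<close>

lemma tilted_mean_upper:
  assumes t: "t > 0"
  shows "tilted_mean k t \<le> 4 / t\<^sup>2"
proof -
  define x where "x = exp (- (t / 2))"
  have x: "0 < x" "x < 1" using t by (auto simp: x_def)
  have "tilted_mean k t \<le> (\<Sum>j=1..k. 2 / t * x ^ j)"
    unfolding tilted_mean_def
  proof (rule sum_mono)
    fix j assume j: "j \<in> {1..k}"
    define y where "y = t * real j"
    have y: "y > 0" using t j by (simp add: y_def)
    have a: "exp y * y \<le> (exp y - 1) * (1 + y)"
      using exp_ge_add_one_self[of y] by (simp add: algebra_simps)
    have "1 + y \<le> 2 * exp (y / 2)" using exp_ge_add_one_self[of "y / 2"] by linarith
    then have "(exp y - 1) * (1 + y) \<le> (exp y - 1) * (2 * exp (y / 2))"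
      using y by (intro mult_left_mono) auto
    with a have "exp y * y \<le> (exp y - 1) * (2 * exp (y / 2))" by (rule order_trans)
    moreover have "exp y = exp (y / 2) * exp (y / 2)" by (simp flip: exp_add)
    ultimately have "exp (y / 2) * (exp (y / 2) * y) \<le> exp (y / 2) * ((exp y - 1) * 2)"
      by (simp only: mult_ac)
    then have "exp (y / 2) * y \<le> (exp y - 1) * 2" by (simp only: mult_le_cancel_left_pos exp_gt_zero)
    then have "y / (exp y - 1) \<le> 2 * exp (- (y / 2))"
      using y by (simp add: exp_minus field_simps)
    then have "y / (exp y - 1) / t \<le> 2 * exp (- (y / 2)) / t"
      using t by (intro divide_right_mono) auto
    moreover have "exp (- (y / 2)) = x ^ j" by (simp add: x_def y_def flip: exp_of_nat_mult)
    ultimately show "real j / (exp (t * real j) - 1) \<le> 2 / t * x ^ j"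
      using t by (simp add: y_def)
  qed
  also have "\<dots> = 2 / t * (\<Sum>j=1..k. x ^ j)" by (simp add: sum_distrib_left)
  also have "\<dots> \<le> 2 / t * (1 / (t / 2))"
  proof (rule mult_left_mono)
    have "(\<Sum>j=1..k. x ^ j) = x * (\<Sum>j<k. x ^ j)"
      by (simp add: sum.atLeast1_atMost_eq sum_distrib_left)
    also have "\<dots> = x * ((1 - x ^ k) / (1 - x))" using x by (subst sum_gp_strict) auto
    also have "\<dots> \<le> x * (1 / (1 - x))" using x by (intro mult_left_mono divide_right_mono) auto
    also have "\<dots> = 1 / (exp (t / 2) - 1)" using t by (simp add: x_def exp_minus field_simps)
    also have "\<dots> \<le> 1 / (t / 2)"
      using exp_ge_add_one_self[of "t / 2"] t by (intro divide_left_mono mult_pos_pos) linarith+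
    finally show "(\<Sum>j=1..k. x ^ j) \<le> 1 / (t / 2)" .
  qed (use t in auto)
  finally show ?thesis using t by (simp add: power2_eq_square field_simps)
qed

lemma ln_one_minus_exp_diff:
  fixes a b :: real
  assumes "0 < a" "a \<le> b"
  shows "ln (1 - exp (- b)) - ln (1 - exp (- a)) \<le> (b - a) / (exp a - 1)"
    and "(b - a) / (exp b - 1) \<le> ln (1 - exp (- b)) - ln (1 - exp (- a))"
proof -
  define X Y where "X = 1 - exp (- b)" and "Y = 1 - exp (- a)"
  have XY: "X > 0" "Y > 0" using assms by (auto simp: X_def Y_def)
  have e: "exp a > 1" "exp b > 1" using assms by auto
  have "ln X - ln Y = ln (X / Y)" using XY by (simp add: ln_div)
  also have "\<dots> \<le> X / Y - 1" using XY by (intro ln_le_minus_one) auto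
  also have "\<dots> = (X - Y) / Y" using XY by (simp add: field_simps)
  also have "\<dots> = (1 - exp (- (b - a))) / (exp a - 1)"
    using e unfolding X_def Y_def exp_minus exp_diff by (simp add: field_simps)
  also have "\<dots> \<le> (b - a) / (exp a - 1)"
    using exp_ge_add_one_self[of "- (b - a)"] e by (intro divide_right_mono) linarith+
  finally show "ln (1 - exp (- b)) - ln (1 - exp (- a)) \<le> (b - a) / (exp a - 1)"
    by (simp add: X_def Y_def)
  have "(b - a) / (exp b - 1) \<le> (exp (b - a) - 1) / (exp b - 1)"
    using exp_ge_add_one_self[of "b - a"] e by (intro divide_right_mono) linarith+
  also have "\<dots> = (X - Y) / X"
    using e unfolding X_def Y_def exp_minus exp_diff by (simp add: field_simps)
  also have "\<dots> = - (Y / X - 1)" using XY by (simp add: field_simps)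
  also have "\<dots> \<le> - ln (Y / X)"
  proof -
    have "ln (Y / X) \<le> Y / X - 1" using XY by (intro ln_le_minus_one) auto
    then show ?thesis by linarith
  qed
  also have "\<dots> = ln X - ln Y" using XY by (simp add: ln_div)
  finally show "(b - a) / (exp b - 1) \<le> ln (1 - exp (- b)) - ln (1 - exp (- a))"
    by (simp add: X_def Y_def)
qed

text \<open>
  Convexity of \<^const>\<open>log_genfun\<close> in \<open>t\<close>, together with its derivative \<open>- tilted_mean k t\<close>.
\<close>

lemma log_genfun_diff:
  assumes "0 < s" "s \<le> s'"
  shows "log_genfun k s - log_genfun k s' \<le> (s' - s) * tilted_mean k s"
    and "(s' - s) * tilted_mean k s' \<le> log_genfun k s - log_genfun k s'"
proof -
  have eq: "log_genfun k s - log_genfun k s' = (\<Sum>j=1..k. ln (1 - exp (- (s' * real j))) - ln (1 - exp (- (s * real j))))"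
    by (simp add: log_genfun_def flip: sum_subtractf)
  have eq2: "(s' - s) * tilted_mean k u = (\<Sum>j=1..k. (s' * real j - s * real j) / (exp (u * real j) - 1))" for u
    by (simp add: tilted_mean_def sum_distrib_left algebra_simps)
  show "log_genfun k s - log_genfun k s' \<le> (s' - s) * tilted_mean k s"
    unfolding eq eq2 using assms by (intro sum_mono ln_one_minus_exp_diff(1)) (auto intro: mult_right_mono)
  show "(s' - s) * tilted_mean k s' \<le> log_genfun k s - log_genfun k s'"
    unfolding eq eq2 using assms by (intro sum_mono ln_one_minus_exp_diff(2)) (auto intro: mult_right_mono)
qed

text \<open>
  Chernoff bounds for the law tilted by \<open>t2\<close>: comparison with \<open>t1\<close> controls the weights above \<open>m\<close>, comparison
  with \<open>t3\<close> those below \<open>B\<close>. By the two hypotheses, each tail has probability at most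
  \<open>exp (- 2) < 1/4\<close>. Half of the mass is thus left for the at most \<open>m + 1\<close> values in between.
\<close>

lemma pcount_large_in_window:
  assumes t: "0 < t1" "t1 < t2" "t2 < t3"
    and up: "(t2 - t1) * (real m + 1 - tilted_mean k t1) \<ge> 2"
    and low: "(t3 - t2) * (tilted_mean k t3 - B) \<ge> 2"
  obtains z where "B \<le> real z" "z \<le> m"
    "real (pcount k z) \<ge> exp (t2 * real z + log_genfun k t2) / (2 * (real m + 1))"
proof (rule ccontr)
  assume neg: "\<not> thesis"
  define G where "G = exp (log_genfun k t2)"
  define p where "p = (\<lambda>z. real (pcount k z))"
  define E where "E = (\<lambda>t z. p z * exp (- (t * real z)))"
  have S: "E t sums exp (log_genfun k t)" if "t > 0" for t
    unfolding E_def p_def by (rule pcount_gen_sums[OF that])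
  have E: "E t z \<ge> 0" for t z by (simp add: E_def p_def)
  define A1 where "A1 = exp (- ((t2 - t1) * (real m + 1)))"
  define A3 where "A3 = exp ((t3 - t2) * B)"
  define W where "W = (\<lambda>z. if z \<in> {..m} then G / (2 * (real m + 1)) else 0)"
  have bound: "E t2 z \<le> A1 * E t1 z + A3 * E t3 z + W z" for z
  proof -
    consider "z > m" | "real z < B" | "B \<le> real z" "z \<le> m" by linarith
    then show ?thesis
    proof cases
      case 1
      then have "(t2 - t1) * (real m + 1) \<le> (t2 - t1) * real z" using t by (intro mult_left_mono) auto
      then have "exp (- (t2 * real z)) \<le> exp (- ((t2 - t1) * (real m + 1)) + - (t1 * real z))"
        by (simp add: algebra_simps)
      then have "exp (- (t2 * real z)) \<le> A1 * exp (- (t1 * real z))"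
        by (simp add: A1_def mult_exp_exp)
      then have "E t2 z \<le> p z * (A1 * exp (- (t1 * real z)))"
        unfolding E_def by (intro mult_left_mono) (auto simp: p_def)
      then have "E t2 z \<le> A1 * E t1 z" by (simp add: E_def mult_ac)
      moreover have "A3 * E t3 z \<ge> 0" "W z \<ge> 0" using E by (auto simp: A3_def W_def G_def)
      ultimately show ?thesis by simp
    next
      case 2
      then have "(t3 - t2) * real z \<le> (t3 - t2) * B" using t by (intro mult_left_mono) auto
      then have "exp (- (t2 * real z)) \<le> exp ((t3 - t2) * B + - (t3 * real z))"
        by (simp add: algebra_simps)
      then have "exp (- (t2 * real z)) \<le> A3 * exp (- (t3 * real z))"
        by (simp add: A3_def mult_exp_exp)
      then have "E t2 z \<le> p z * (A3 * exp (- (t3 * real z)))"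
        unfolding E_def by (intro mult_left_mono) (auto simp: p_def)
      then have "E t2 z \<le> A3 * E t3 z" by (simp add: E_def mult_ac)
      moreover have "A1 * E t1 z \<ge> 0" "W z \<ge> 0" using E by (auto simp: A1_def W_def G_def)
      ultimately show ?thesis by simp
    next
      case 3
      then have "p z < exp (t2 * real z + log_genfun k t2) / (2 * (real m + 1))"
        using neg that[of z] unfolding p_def by (meson not_le)
      then have "E t2 z \<le> exp (t2 * real z + log_genfun k t2) / (2 * (real m + 1)) * exp (- (t2 * real z))"
        unfolding E_def by (intro mult_right_mono) auto
      also have "\<dots> = W z" using 3 by (simp add: W_def G_def exp_add exp_minus)
      finally have "E t2 z \<le> W z" .
      moreover have "A1 * E t1 z \<ge> 0" "A3 * E t3 z \<ge> 0" using E by (auto simp: A1_def A3_def)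
      ultimately show ?thesis by simp
    qed
  qed
  have "W sums (\<Sum>z\<in>{..m}. G / (2 * (real m + 1)))"
    unfolding W_def by (rule sums_If_finite_set) auto
  also have "(\<Sum>z\<in>{..m}. G / (2 * (real m + 1))) = G / 2" by (simp add: field_simps)
  finally have "W sums (G / 2)" .
  then have "(\<lambda>z. A1 * E t1 z + A3 * E t3 z + W z) sums (A1 * exp (log_genfun k t1) + A3 * exp (log_genfun k t3) + G / 2)"
    using t by (intro sums_add sums_mult S) auto
  from sums_le[OF bound S this] have main: "G \<le> A1 * exp (log_genfun k t1) + A3 * exp (log_genfun k t3) + G / 2"
    using t by (simp add: G_def)
  have "A1 * exp (log_genfun k t1) = exp (log_genfun k t2 + (log_genfun k t1 - log_genfun k t2 - (t2 - t1) * (real m + 1)))"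
    by (simp add: A1_def flip: exp_add)
  also have "\<dots> \<le> exp (log_genfun k t2 + (- 2))"
    using log_genfun_diff(1)[of t1 t2 k] t up by (intro exp_mono) (simp add: algebra_simps)
  also have "\<dots> = G * exp (- 2)" by (simp add: G_def mult_exp_exp)
  finally have 1: "A1 * exp (log_genfun k t1) \<le> G * exp (- 2)" .
  have "A3 * exp (log_genfun k t3) = exp (log_genfun k t2 + (log_genfun k t3 - log_genfun k t2 + (t3 - t2) * B))"
    by (simp add: A3_def flip: exp_add)
  also have "\<dots> \<le> exp (log_genfun k t2 + (- 2))"
    using log_genfun_diff(2)[of t2 t3 k] t low by (intro exp_mono) (simp add: algebra_simps)
  also have "\<dots> = G * exp (- 2)" by (simp add: G_def mult_exp_exp)
  finally have 3: "A3 * exp (log_genfun k t3) \<le> G * exp (- 2)" .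
  have "exp (2 :: real) > 4"
  proof -
    have "exp (2 :: real) = exp 1 * exp 1" by (simp flip: exp_add)
    moreover have "exp (1 :: real) > 2" using e_less_272 exp_lower_Taylor_quadratic[of 1] by simp
    ultimately show ?thesis using mult_strict_mono[of 2 "exp (1::real)" 2 "exp 1"] by simp
  qed
  then have "exp (- 2 :: real) < 1 / 4" by (simp add: exp_minus field_simps)
  then have "G * exp (- 2) < G * (1 / 4)" by (intro mult_strict_left_mono) (auto simp: G_def)
  with main 1 3 show False by simp
qed

text \<open>
  Four equidistant tilts \<open>t0 < t1 < t2 < t3\<close> with step \<open>d\<close> are used. At \<open>t0\<close> the mean exceeds \<open>m\<close>, as the
  minimum principle requires. The bound \<open>V\<close> on the variance pushes the mean at \<open>t1\<close> far enough below \<open>m\<close> for the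
  upper tail at \<open>t2\<close> to be small. The mean at \<open>t3\<close> is still close enough to \<open>m\<close> for the window given
  by \<open>pcount_large_in_window\<close> to be short. The loss is the product of
  \<open>t2 - t0 = 2 d\<close> and the length of the window, plus \<open>t0 L\<close> from the minimum principle.
\<close>

lemma pcount_lower_explicit:
  assumes t0: "t0 > 0" and d: "d > 0" "3 * d \<le> t0" "d \<le> 1" and k: "k > 0"
    and tilted_mean: "tilted_mean k t0 = real m + 2"
    and V: "V \<le> (\<Sum>j=1..k. (real j)\<^sup>2 * exp (- (2 * t0 * real j)))" "d\<^sup>2 * V \<ge> 3"
  shows "real (pcount k m) \<ge> exp ((t0 + 2 * d) * real m + log_genfun k (t0 + 2 * d)
     - (6 * d\<^sup>2 * (real k * (1 + t0 * real k) / t0\<^sup>2) + 4 + t0 * real k + ln (real m + 2) + t0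
        + ln (2 * (real m + 1))))"
proof -
  define U where "U = real k * (1 + t0 * real k) / t0\<^sup>2"
  define t1 t2 t3 where "t1 = t0 + d" and "t2 = t0 + 2 * d" and "t3 = t0 + 3 * d"
  \<comment> \<open>The term \<open>2 / d\<close> makes the Chernoff exponent of the lower tail at least 2.\<close>
  define B where "B = real m + 2 - 3 * d * U - 2 / d"
  have "(t1 - t0) * V \<le> (t1 - t0) * (\<Sum>j=1..k. (real j)\<^sup>2 * exp (- (t1 * real j)))"
  proof (rule mult_left_mono, rule order_trans[OF V(1)], intro sum_mono mult_left_mono)
    fix j
    show "exp (- (2 * t0 * real j)) \<le> exp (- (t1 * real j))"
      using d t0 by (auto simp: t1_def intro!: mult_right_mono)
  qed (use d in \<open>auto simp: t1_def\<close>)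
  also have "\<dots> \<le> tilted_mean k t0 - tilted_mean k t1" using t0 d by (intro tilted_mean_diff_lower) (auto simp: t1_def)
  finally have mu1: "tilted_mean k t1 \<le> real m + 2 - d * V" using tilted_mean by (simp add: t1_def)
  have "tilted_mean k t0 - tilted_mean k t3 \<le> (t3 - t0) * U"
    unfolding U_def using t0 d by (intro tilted_mean_diff_upper) (auto simp: t3_def)
  then have mu3: "tilted_mean k t3 \<ge> real m + 2 - 3 * d * U" using tilted_mean by (simp add: t3_def)
  have up: "(t2 - t1) * (real m + 1 - tilted_mean k t1) \<ge> 2"
  proof -
    have "2 \<le> d * (d * V - 1)" using V(2) d by (simp add: algebra_simps power2_eq_square)
    also have "\<dots> \<le> d * (real m + 1 - tilted_mean k t1)" using mu1 d by (intro mult_left_mono) auto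
    finally show ?thesis by (simp add: t1_def t2_def)
  qed
  have low: "(t3 - t2) * (tilted_mean k t3 - B) \<ge> 2"
  proof -
    have "2 = d * (2 / d)" using d by simp
    also have "\<dots> \<le> d * (tilted_mean k t3 - B)" using mu3 d by (intro mult_left_mono) (auto simp: B_def)
    finally show ?thesis by (simp add: t3_def t2_def)
  qed
  have tt: "0 < t1" "t1 < t2" "t2 < t3" using t0 d by (auto simp: t1_def t2_def t3_def)
  obtain z where z: "B \<le> real z" "z \<le> m"
    "real (pcount k z) \<ge> exp (t2 * real z + log_genfun k t2) / (2 * (real m + 1))"
    using pcount_large_in_window[OF tt up low] by blast
  \<comment> \<open>The truncation at \<open>L\<close> loses a fraction \<open>1 / (m + 2)\<close> of the mean \<open>m + 2\<close>, so at least \<open>m\<close> is left.\<close>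
  define L where "L = k + nat \<lceil>ln (real m + 2) / t0\<rceil>"
  have lnm: "ln (real m + 2) \<ge> 0" by simp
  have L: "real L - real k \<ge> ln (real m + 2) / t0" "real L \<le> real k + ln (real m + 2) / t0 + 1"
    using lnm t0 by (auto simp: L_def)
  have "real m \<le> (\<Sum>j=1..k. \<Sum>r=1..L div j. real j * exp (- (t0 * real (r * j))))"
  proof -
    have "t0 * (real L - real k) \<ge> ln (real m + 2)" using L t0 by (simp add: field_simps)
    then have "exp (- (t0 * (real L - real k))) \<le> exp (- ln (real m + 2))" by simp
    also have "\<dots> = 1 / (real m + 2)" by (simp add: exp_minus field_simps)
    finally have *: "exp (- (t0 * (real L - real k))) \<le> 1 / (real m + 2)" .
    have "real m \<le> (1 - 1 / (real m + 2)) * (real m + 2)" by (simp add: field_simps)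
    also have "\<dots> = (1 - 1 / (real m + 2)) * tilted_mean k t0" by (simp only: tilted_mean)
    also have "\<dots> \<le> (1 - exp (- (t0 * (real L - real k)))) * tilted_mean k t0"
      using tilted_mean * by (intro mult_right_mono) auto
    also have "\<dots> \<le> (\<Sum>j=1..k. \<Sum>r=1..L div j. real j * exp (- (t0 * real (r * j))))"
      by (rule tilted_mean_truncated[OF t0])
    finally show ?thesis .
  qed
  note step = pcount_minimum_principle[OF k t0 z(2) this]
  have "t2 * real m + log_genfun k t2 - (6 * d\<^sup>2 * U + 4 + t0 * real k + ln (real m + 2) + t0 + ln (2 * (real m + 1)))
      \<le> (t0 * (real m - real z) - t0 * real L) + (t2 * real z + log_genfun k t2) - ln (2 * (real m + 1))"
  proof -
    have "2 * d * (real m - real z) \<le> 2 * d * (3 * d * U + 2 / d)"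
      using z(1) d by (intro mult_left_mono) (auto simp: B_def)
    also have "\<dots> = 6 * d\<^sup>2 * U + 4" using d by (simp add: field_simps power2_eq_square)
    finally have "2 * d * real m \<le> 2 * d * real z + 6 * d\<^sup>2 * U + 4" by (simp add: algebra_simps)
    moreover have "t0 * real L \<le> t0 * (real k + ln (real m + 2) / t0 + 1)"
      using L t0 by (intro mult_left_mono) auto
    then have "t0 * real L \<le> t0 * real k + ln (real m + 2) + t0" using t0 by (simp add: algebra_simps)
    ultimately show ?thesis by (simp add: t2_def algebra_simps)
  qed
  then have "exp (t2 * real m + log_genfun k t2 - (6 * d\<^sup>2 * U + 4 + t0 * real k + ln (real m + 2) + t0 + ln (2 * (real m + 1))))
      \<le> exp ((t0 * (real m - real z) - t0 * real L) + (t2 * real z + log_genfun k t2) - ln (2 * (real m + 1)))"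
    by simp
  also have "\<dots> = exp (t0 * (real m - real z) - t0 * real L) * (exp (t2 * real z + log_genfun k t2) / (2 * (real m + 1)))"
    by (simp only: exp_diff[of _ "ln _"] exp_add exp_ln) simp
  also have "\<dots> \<le> exp (t0 * (real m - real z) - t0 * real L) * real (pcount k z)"
    using z(3) by (intro mult_left_mono) auto
  also have "\<dots> \<le> real (pcount k m)" by (rule step)
  finally show ?thesis by (simp add: U_def t2_def)
qed

lemma sum_squares_ge_cube: "real n ^ 3 / 3 \<le> (\<Sum>j=1..n. (real j)\<^sup>2)"
proof (induction n)
  case (Suc n)
  have "real (Suc n) ^ 3 / 3 \<le> real n ^ 3 / 3 + (real (Suc n))\<^sup>2"
    by (simp add: power2_eq_square power3_eq_cube algebra_simps)
  with Suc show ?case by simp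
qed simp

lemma continuous_on_tilted_mean: "continuous_on {0<..} (tilted_mean k)"
  unfolding tilted_mean_def by (intro continuous_intros) (auto simp: less_imp_neq)

text \<open>
  In this range of \<open>k\<close>, the tilt with mean \<open>m + 2\<close> has order \<open>1 / sqrt m\<close>, and the variance has order
  \<open>m powr (3/2)\<close> up to factors \<open>m powr \<epsilon>\<close>. The step \<open>d\<close> is the inverse of the standard deviation up to
  a constant, which makes both the loss and the Chernoff exponents bounded up to such factors.
\<close>

lemma pcount_lower_bound:
  fixes c \<epsilon> :: real
  assumes c: "0 < c" "c \<le> 1" and \<epsilon>: "0 < \<epsilon>"
  shows "\<exists>C\<ge>0. \<forall>\<^sub>F m in sequentially. \<forall>k. c * sqrt (real m) \<le> real k \<and> real k \<le> real m powr (1/2 + \<epsilon>) \<longrightarrow>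
     (\<exists>t. c / (8 * sqrt (real m)) \<le> t \<and> t \<le> 4 / sqrt (real m) \<and>
       exp (t * real m + log_genfun k t - C * real m powr (2 * \<epsilon>)) \<le> real (pcount k m))"
proof -
  define v where "v = exp (-4) * c ^ 3 / 24"
  have v: "v > 0" using c by (simp add: v_def)
  \<comment> \<open>\<open>v * m powr (3/2)\<close> will be a lower bound on the variance, and \<open>C0\<close> collects the constants
    in \<open>6 * d\<^sup>2 * (k * (1 + t0 * k) / t0\<^sup>2)\<close>, using \<open>d\<^sup>2 = 3 / V\<close> and \<open>t0 \<ge> c / (8 * sqrt m)\<close>.\<close>
  define C0 where "C0 = 18 * 64 / (c\<^sup>2 * v)"
  have C0: "C0 \<ge> 0" using v by (simp add: C0_def)
  define C where "C = 3 * C0 + 3"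
  have ev: "\<forall>\<^sub>F m in sequentially. m \<ge> 1 \<and> 2 * real m \<ge> real m + 2 \<and> c * sqrt (real m) \<ge> 2
     \<and> sqrt (3 / (v * real m powr (3/2))) \<le> c / (24 * sqrt (real m))
     \<and> sqrt (3 / (v * real m powr (3/2))) \<le> 1
     \<and> ln (real m + 2) + ln (2 * (real m + 1)) + 6 \<le> real m powr (2 * \<epsilon>)"
    using c \<epsilon> v by (intro eventually_conj) real_asymp+
  have "\<forall>\<^sub>F m in sequentially. \<forall>k. c * sqrt (real m) \<le> real k \<and> real k \<le> real m powr (1/2 + \<epsilon>) \<longrightarrow>
     (\<exists>t. c / (8 * sqrt (real m)) \<le> t \<and> t \<le> 4 / sqrt (real m) \<and>
       exp (t * real m + log_genfun k t - C * real m powr (2 * \<epsilon>)) \<le> real (pcount k m))"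
    using ev
  proof (eventually_elim, intro allI impI, elim conjE)
    fix m k :: nat
    assume m: "1 \<le> m" "real m + 2 \<le> 2 * real m" "2 \<le> c * sqrt (real m)"
      and d1: "sqrt (3 / (v * real m powr (3/2))) \<le> c / (24 * sqrt (real m))"
      and d2: "sqrt (3 / (v * real m powr (3/2))) \<le> 1"
      and ln: "ln (real m + 2) + ln (2 * (real m + 1)) + 6 \<le> real m powr (2 * \<epsilon>)"
      and k: "c * sqrt (real m) \<le> real k" "real k \<le> real m powr (1/2 + \<epsilon>)"
    define s where "s = sqrt (real m)"
    have s: "s \<ge> 1" "s\<^sup>2 = real m" "s * s = real m" using m by (auto simp: s_def)
    define k0 where "k0 = nat \<lfloor>c * s\<rfloor>"
    have k0: "real k0 \<le> c * s" "c * s / 2 \<le> real k0" "k0 \<le> k"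
      using m(3) k(1) by (auto simp: k0_def s_def) linarith+
    \<comment> \<open>The mean at \<open>hi\<close> is at most \<open>4 / hi\<^sup>2 = m + 2\<close>. At \<open>lo\<close> the first \<open>c * sqrt m\<close> terms alone
      contribute at least \<open>1 / (2 * lo)\<close> each, which adds up to at least \<open>2 * m\<close>.\<close>
    define lo hi where "lo = c / (8 * s)" and "hi = 2 / sqrt (real m + 2)"
    have lohi: "0 < lo" "lo \<le> hi"
    proof -
      show "0 < lo" using c s by (simp add: lo_def)
      have "sqrt (real m + 2) \<le> sqrt (4 * real m)" using m by (intro real_sqrt_le_mono) linarith
      also have "\<dots> = 2 * s" by (simp add: s_def real_sqrt_mult)
      finally have "2 / (2 * s) \<le> hi" unfolding hi_def using s by (intro divide_left_mono) auto
      moreover have "lo \<le> 2 / (2 * s)" using c s by (simp add: lo_def field_simps)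
      ultimately show "lo \<le> hi" by linarith
    qed
    have hi_le: "hi \<le> 2 / s" unfolding hi_def s_def using m by (intro divide_left_mono) auto
    have "tilted_mean k hi \<le> 4 / hi\<^sup>2" using lohi by (intro tilted_mean_upper) auto
    also have "\<dots> = real m + 2" by (simp add: hi_def power_divide)
    finally have mu_hi: "tilted_mean k hi \<le> real m + 2" .
    have mu_lo: "tilted_mean k lo \<ge> real m + 2"
    proof -
      have "1 / (2 * lo) \<le> real j / (exp (lo * real j) - 1)" if "j \<in> {1..k0}" for j
      proof -
        have "lo * real j \<le> lo * (c * s)" using that k0(1) lohi by (intro mult_left_mono) auto
        also have "\<dots> = c\<^sup>2 / 8" using s by (simp add: lo_def power2_eq_square)
        also have "\<dots> \<le> 1" using c power_le_one[of c 2] by simp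
        finally have le1: "lo * real j \<le> 1" .
        have pos: "lo * real j > 0" using that lohi by simp
        have "exp (lo * real j) \<le> 1 + lo * real j + (lo * real j)\<^sup>2"
          using le1 pos by (intro exp_bound) auto
        also have "(lo * real j)\<^sup>2 \<le> lo * real j"
          using mult_left_mono[OF le1, of "lo * real j"] pos by (simp add: power2_eq_square)
        finally have "exp (lo * real j) - 1 \<le> 2 * (lo * real j)" by simp
        then have "real j / (2 * (lo * real j)) \<le> real j / (exp (lo * real j) - 1)"
          using pos lohi that by (intro divide_left_mono mult_pos_pos) auto
        then show ?thesis using that by simp
      qed
      then have "(\<Sum>j=1..k0. 1 / (2 * lo)) \<le> (\<Sum>j=1..k0. real j / (exp (lo * real j) - 1))"
        by (intro sum_mono) auto
      also have "\<dots> \<le> tilted_mean k lo"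
        unfolding tilted_mean_def using k0 lohi by (intro sum_mono2) auto
      finally have "real k0 / (2 * lo) \<le> tilted_mean k lo" by simp
      moreover have "(c * s / 2) / (2 * lo) \<le> real k0 / (2 * lo)"
        using k0 lohi by (intro divide_right_mono) auto
      moreover have "(c * s / 2) / (2 * lo) = 2 * real m"
        using c s by (simp add: lo_def field_simps)
      ultimately show ?thesis using m by linarith
    qed
    obtain t0 where t0: "lo \<le> t0" "t0 \<le> hi" "tilted_mean k t0 = real m + 2"
      using IVT2'[of "tilted_mean k" hi "real m + 2" lo] mu_hi mu_lo lohi
        continuous_on_subset[OF continuous_on_tilted_mean, of "{lo..hi}" k] by force
    have t0pos: "t0 > 0" using t0 lohi by linarith
    have t0hi: "t0 \<le> 2 / s" using t0 hi_le by linarith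
    define V where "V = v * real m powr (3/2)"
    have mp: "real m powr (3/2) = s ^ 3"
    proof -
      have "s = real m powr (1/2)" using m by (simp add: s_def powr_half_sqrt)
      then show ?thesis using m by (simp add: powr_powr flip: powr_realpow)
    qed
    have Vpos: "V > 0" using v m by (simp add: V_def)
    define d where "d = sqrt (3 / V)"
    have d: "d > 0" "d\<^sup>2 = 3 / V" using Vpos by (auto simp: d_def)
    have d3: "3 * d \<le> t0"
    proof -
      have "d \<le> c / (24 * s)" using d1 by (simp add: d_def V_def s_def)
      moreover have "3 * (c / (24 * s)) = lo" by (simp add: lo_def)
      ultimately show ?thesis using t0(1) by linarith
    qed
    have Vle: "V \<le> (\<Sum>j=1..k. (real j)\<^sup>2 * exp (- (2 * t0 * real j)))"
    proof -
      have "V = exp (-4) * ((c * s / 2) ^ 3 / 3)"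
        unfolding V_def mp v_def by (simp add: power_mult_distrib power_divide)
      also have "\<dots> \<le> exp (-4) * (real k0 ^ 3 / 3)"
        using k0 c s by (intro mult_left_mono divide_right_mono power_mono) auto
      also have "\<dots> \<le> exp (-4) * (\<Sum>j=1..k0. (real j)\<^sup>2)"
        by (intro mult_left_mono sum_squares_ge_cube) auto
      also have "\<dots> \<le> (\<Sum>j=1..k0. (real j)\<^sup>2 * exp (- (2 * t0 * real j)))"
        unfolding sum_distrib_left
      proof (rule sum_mono)
        fix j assume j: "j \<in> {1..k0}"
        have "t0 * real j \<le> (2 / s) * (c * s)" using j k0(1) t0hi t0pos s by (intro mult_mono) auto
        also have "\<dots> \<le> 2" using c s by simp
        finally show "exp (-4) * (real j)\<^sup>2 \<le> (real j)\<^sup>2 * exp (- (2 * t0 * real j))"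
          by (simp add: mult.commute[of "exp (-4)"] mult_left_mono)
      qed
      also have "\<dots> \<le> (\<Sum>j=1..k. (real j)\<^sup>2 * exp (- (2 * t0 * real j)))"
        using k0 by (intro sum_mono2) auto
      finally show ?thesis .
    qed
    have kpos: "k > 0" using k0 m(3) by (auto simp: s_def)
    define t where "t = t0 + 2 * d"
    define loss where "loss = 6 * d\<^sup>2 * (real k * (1 + t0 * real k) / t0\<^sup>2) + 4 + t0 * real k + ln (real m + 2) + t0
        + ln (2 * (real m + 1))"
    have main: "exp (t * real m + log_genfun k t - loss) \<le> real (pcount k m)"
      unfolding t_def loss_def
      using d d2 Vpos kpos m by (intro pcount_lower_explicit[where V = V] t0 t0pos d3 Vle) (auto simp: d_def V_def)
    define P where "P = real m powr \<epsilon>"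
    have P: "P \<ge> 1" "real m powr (2 * \<epsilon>) = P * P" "real m powr (1/2 + \<epsilon>) = s * P"
    proof -
      show "P \<ge> 1" using m \<epsilon> by (simp add: P_def ge_one_powr_ge_zero)
      show "real m powr (2 * \<epsilon>) = P * P" by (simp add: P_def flip: powr_add)
      show "real m powr (1/2 + \<epsilon>) = s * P" by (simp add: P_def s_def powr_add powr_half_sqrt)
    qed
    have t0k: "t0 * real k \<le> 2 * P"
    proof -
      have "t0 * real k \<le> (2 / s) * (s * P)" using t0hi k(2) t0pos s P by (intro mult_mono) auto
      then show ?thesis using s by simp
    qed
    have "6 * d\<^sup>2 * (real k * (1 + t0 * real k) / t0\<^sup>2) \<le> 6 * (3 / V) * ((s * P) * (3 * P) / lo\<^sup>2)"
      unfolding d(2) using Vpos k(2) P t0k t0 t0pos lohi s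
      by (intro mult_left_mono frac_le mult_mono power_mono mult_nonneg_nonneg) auto
    also have "\<dots> = 3 * C0 * (P * P)"
      unfolding V_def mp lo_def C0_def using s(1) c v
      by (simp add: field_simps power2_eq_square power3_eq_cube)
    finally have l1: "6 * d\<^sup>2 * (real k * (1 + t0 * real k) / t0\<^sup>2) \<le> 3 * C0 * (P * P)" .
    have PP: "P \<le> P * P" using P by simp
    have "2 / s \<le> 2" using s(1) by (simp add: divide_le_eq)
    then have "t0 \<le> 2" using t0hi by linarith
    then have "loss \<le> 3 * C0 * (P * P) + 4 + 2 * (P * P) + ln (real m + 2) + 2 + ln (2 * (real m + 1))"
      using l1 t0k PP unfolding loss_def by linarith
    also have "\<dots> \<le> 3 * C0 * (P * P) + 2 * (P * P) + P * P" using ln P(2) by linarith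
    also have "\<dots> = C * real m powr (2 * \<epsilon>)" by (simp only: C_def P(2)) (simp add: algebra_simps)
    finally have "exp (t * real m + log_genfun k t - C * real m powr (2 * \<epsilon>)) \<le> exp (t * real m + log_genfun k t - loss)"
      by simp
    with main have "exp (t * real m + log_genfun k t - C * real m powr (2 * \<epsilon>)) \<le> real (pcount k m)" by linarith
    moreover have "c / (8 * sqrt (real m)) \<le> t" using t0(1) d by (simp add: t_def lo_def s_def)
    moreover have "t \<le> 4 / sqrt (real m)" using t0hi d3 d t0pos by (simp add: t_def s_def)
    ultimately show "\<exists>t. c / (8 * sqrt (real m)) \<le> t \<and> t \<le> 4 / sqrt (real m) \<and>
       exp (t * real m + log_genfun k t - C * real m powr (2 * \<epsilon>)) \<le> real (pcount k m)" by blast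
  qed
  moreover have "C \<ge> 0" using C0 by (simp add: C_def)
  ultimately show ?thesis by blast
qed

section \<open>The continuous approximation of the logarithmic generating function\<close>

lemma Li2_nonneg: "0 \<le> x \<Longrightarrow> x \<le> 1 \<Longrightarrow> Li2 x \<ge> 0"
  unfolding Li2_def by (intro suminf_nonneg summable_Li2) auto

lemma Li2_pos:
  assumes "0 < x" "x \<le> 1"
  shows "Li2 x > 0"
proof -
  have "(\<Sum>k\<in>{0::nat}. x ^ Suc k / real (Suc k) ^ 2) \<le> Li2 x"
    unfolding Li2_def using assms by (intro sum_le_suminf summable_Li2) auto
  then show ?thesis using assms by simp
qed

lemma Li2_le_linear:
  assumes "0 \<le> x" "x \<le> 1"
  shows "Li2 x \<le> Li2 1 * x"
proof -
  have "Li2 x \<le> (\<Sum>k. 1 ^ Suc k / real (Suc k) ^ 2 * x)"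
    unfolding Li2_def
  proof (intro suminf_le summable_Li2 summable_mult2 assms)
    fix k
    have "x ^ Suc k \<le> x" using assms by (simp add: mult_left_le power_le_one)
    then have "x ^ Suc k / real (Suc k) ^ 2 \<le> x / real (Suc k) ^ 2" by (intro divide_right_mono) auto
    then show "x ^ Suc k / real (Suc k) ^ 2 \<le> 1 ^ Suc k / real (Suc k) ^ 2 * x" by simp
  qed auto
  also have "\<dots> = Li2 1 * x"
    unfolding Li2_def by (rule suminf_mult2[symmetric]) (rule summable_Li2, auto)
  finally show ?thesis .
qed

text \<open>
  Termwise differentiation, followed by the power series of \<open>ln (1 - x)\<close>.
\<close>

lemma Li2_has_derivative:
  assumes "0 < x" "x < 1"
  shows "(Li2 has_real_derivative - ln (1 - x) / x) (at x)"
proof -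
  define c :: "nat \<Rightarrow> real" where "c = (\<lambda>n. 1 / real n ^ 2)"
  have summ: "summable (\<lambda>n. c n * y ^ n)" if "0 \<le> y" "y \<le> 1" for y
    using summable_Li2[OF that] by (subst summable_Suc_iff[symmetric]) (simp add: c_def)
  have Li2_eq: "Li2 y = (\<Sum>n. c n * y ^ n)" if "0 \<le> y" "y \<le> 1" for y
    using suminf_split_head[OF summ[OF that]] by (simp add: Li2_def c_def)
  have der: "((\<lambda>y. \<Sum>n. c n * y ^ n) has_real_derivative (\<Sum>n. diffs c n * x ^ n)) (at x)"
    using assms summ[of 1] by (intro termdiffs_strong[of c 1]) auto
  have "(Li2 has_real_derivative (\<Sum>n. diffs c n * x ^ n)) (at x)"
  proof (rule has_field_derivative_transform_within_open[OF der])
    show "(\<Sum>n. c n * y ^ n) = Li2 y" if "y \<in> {0<..<1}" for y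
      using Li2_eq[of y] that by simp
  qed (use assms in auto)
  moreover have "(\<Sum>n. diffs c n * x ^ n) = - ln (1 - x) / x"
  proof -
    have d: "diffs c n = 1 / real (Suc n)" for n by (simp add: diffs_def c_def power2_eq_square)
    have s: "summable (\<lambda>n. diffs c n * x ^ n)"
      using assms powser_inside[OF summ[of 1]] by (intro termdiff_converges[of _ 1 c]) auto
    have "ln (1 - x) = (\<Sum>n. (-1) ^ n * (1 / real (n + 1)) * (1 - x - 1) ^ Suc n)"
      using assms by (intro ln_series) auto
    also have "(\<lambda>n. (-1) ^ n * (1 / real (n + 1)) * (1 - x - 1) ^ Suc n) = (\<lambda>n. (- x) * (diffs c n * x ^ n))"
    proof
      fix n
      have "(- x) ^ Suc n = (-1) ^ Suc n * x ^ Suc n" by (rule power_minus)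
      then show "(-1) ^ n * (1 / real (n + 1)) * (1 - x - 1) ^ Suc n = (- x) * (diffs c n * x ^ n)"
        by (simp add: d field_simps flip: power_mult_distrib)
    qed
    also have "(\<Sum>n. (- x) * (diffs c n * x ^ n)) = (- x) * (\<Sum>n. diffs c n * x ^ n)"
      by (rule suminf_mult[OF s])
    finally show ?thesis using assms by simp
  qed
  ultimately show ?thesis by simp
qed

definition nlog :: "real \<Rightarrow> real" where
  "nlog x = - ln (1 - exp (- x))"

text \<open>
  \<open>Phi x\<close> is the integral of \<^const>\<open>nlog\<close> over \<open>{0..x}\<close>, integrated by parts: the remaining integrand
  \<open>u / (exp u - 1)\<close> is the derivative of \<open>Li2 (1 - exp (- u))\<close>. This form produces
  the dilogarithm in \<^const>\<open>theta_const\<close> directly.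
\<close>

definition Phi :: "real \<Rightarrow> real" where
  "Phi x = Li2 (1 - exp (- x)) + x * nlog x"

lemma nlog_antimono: "0 < x \<Longrightarrow> x \<le> y \<Longrightarrow> nlog y \<le> nlog x"
  by (auto simp: nlog_def)

lemma nlog_nonneg: "0 < x \<Longrightarrow> nlog x \<ge> 0"
  by (auto simp: nlog_def)

lemma Li2_exp_has_derivative:
  assumes "x > 0"
  shows "((\<lambda>x. Li2 (1 - exp (- x))) has_real_derivative x / (exp x - 1)) (at x)"
proof -
  have r: "0 < 1 - exp (- x)" "1 - exp (- x) < 1" using assms by auto
  have "((\<lambda>x. Li2 (1 - exp (- x))) has_real_derivative
      (- ln (1 - (1 - exp (- x))) / (1 - exp (- x))) * exp (- x)) (at x)"
    by (rule DERIV_chain2[where f = Li2 and g = "\<lambda>x. 1 - exp (- x)", OF Li2_has_derivative[OF r]]) (auto intro!: derivative_eq_intros)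
  moreover have "ln (1 - (1 - exp (- x))) = - x" by simp
  moreover have "(- (- x) / (1 - exp (- x))) * exp (- x) = x / (exp x - 1)"
    using assms by (simp add: exp_minus field_simps)
  ultimately show ?thesis by simp
qed

lemma Phi_has_derivative:
  assumes "x > 0"
  shows "(Phi has_real_derivative nlog x) (at x)"
proof -
  have "((\<lambda>x. Li2 (1 - exp (- x)) + x * - ln (1 - exp (- x))) has_real_derivative
     x / (exp x - 1) + (1 * - ln (1 - exp (- x)) + - (exp (- x) / (1 - exp (- x))) * x)) (at x)"
    using assms
    by (intro DERIV_add DERIV_mult Li2_exp_has_derivative)
       (auto intro!: derivative_eq_intros simp: field_simps)
  moreover have "x / (exp x - 1) = exp (- x) / (1 - exp (- x)) * x"
    using assms by (simp add: exp_minus field_simps)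
  then have "x / (exp x - 1) + (1 * - ln (1 - exp (- x)) + - (exp (- x) / (1 - exp (- x))) * x) = nlog x"
    by (simp add: nlog_def)
  moreover have "Phi = (\<lambda>x. Li2 (1 - exp (- x)) + x * - ln (1 - exp (- x)))"
    by (simp add: fun_eq_iff Phi_def nlog_def)
  ultimately show ?thesis by simp
qed

lemma Phi_diff:
  assumes "0 < a" "a \<le> b"
  shows "(b - a) * nlog b \<le> Phi b - Phi a" "Phi b - Phi a \<le> (b - a) * nlog a"
proof -
  have "(b - a) * nlog b \<le> Phi b - Phi a \<and> Phi b - Phi a \<le> (b - a) * nlog a"
  proof (cases "a = b")
    case False
    obtain z where "a < z" "z < b" "Phi b - Phi a = (b - a) * nlog z"
      using MVT2[of a b Phi nlog] Phi_has_derivative assms False by force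
    then show ?thesis
      using nlog_antimono[of z b] nlog_antimono[of a z] assms by (simp add: mult_left_mono)
  qed simp
  then show "(b - a) * nlog b \<le> Phi b - Phi a" "Phi b - Phi a \<le> (b - a) * nlog a" by auto
qed

lemma Phi_mono: "0 < a \<Longrightarrow> a \<le> b \<Longrightarrow> Phi a \<le> Phi b"
  using Phi_diff(1)[of a b] nlog_nonneg[of b] mult_nonneg_nonneg[of "b - a" "nlog b"] by linarith

lemma Phi_tangent:
  assumes "0 < x" "0 < T"
  shows "Phi x \<le> Phi T + nlog T * (x - T)"
  using Phi_diff(1)[of x T] Phi_diff(2)[of T x] assms
  by (cases "x \<le> T") (auto simp: algebra_simps)

lemma log_genfun_Suc: "log_genfun (Suc k) t = log_genfun k t + nlog (t * real (Suc k))"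
  by (simp add: log_genfun_def nlog_def)

text \<open>
  A sum of values of the decreasing function \<^const>\<open>nlog\<close> lies below its integral. The first step has to
  use the closed form of \<^const>\<open>Phi\<close>, as \<^const>\<open>nlog\<close> is unbounded at 0.
\<close>

lemma log_genfun_upper:
  assumes "t > 0" "k > 0"
  shows "log_genfun k t \<le> Phi (real k * t) / t"
  using assms(2)
proof (induction k rule: nat_induct_non_zero)
  case 1
  have "Li2 (1 - exp (- t)) \<ge> 0" using assms by (intro Li2_nonneg) auto
  then show ?case using assms log_genfun_Suc[of 0 t] by (simp add: log_genfun_def[of 0] Phi_def field_simps)
next
  case (Suc k)
  have "(t * real (Suc k) - t * real k) * nlog (t * real (Suc k)) \<le> Phi (t * real (Suc k)) - Phi (t * real k)"
    using assms Suc.hyps by (intro Phi_diff) auto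
  then have "nlog (t * real (Suc k)) \<le> (Phi (t * real (Suc k)) - Phi (t * real k)) / t"
    using assms by (simp add: field_simps)
  then show ?case using Suc.IH unfolding log_genfun_Suc by (simp add: diff_divide_distrib mult.commute)
qed

lemma pcount_upper_Phi:
  assumes "t > 0" "k > 0"
  shows "real (pcount k m) \<le> exp (t * real m + Phi (real k * t) / t)"
proof -
  have "real (pcount k m) \<le> exp (t * real m + log_genfun k t)" by (rule pcount_upper[OF assms(1)])
  also have "\<dots> \<le> exp (t * real m + Phi (real k * t) / t)" using log_genfun_upper[OF assms] by simp
  finally show ?thesis .
qed

lemma Phi_over_arg:
  assumes "t > 0"
  shows "Phi t / t \<le> Li2 1 + ln (1 + 1 / t)"
proof -
  have "1 - exp (- t) \<le> t" using exp_ge_add_one_self[of "- t"] by simp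
  moreover have "Li2 (1 - exp (- t)) \<le> Li2 1 * (1 - exp (- t))"
    using assms by (intro Li2_le_linear) auto
  ultimately have "Li2 (1 - exp (- t)) \<le> Li2 1 * t"
    using mult_left_mono[of "1 - exp (- t)" t "Li2 1"] Li2_nonneg[of 1] by simp
  moreover have "nlog t \<le> ln (1 + 1 / t)"
  proof -
    have "exp (- t) \<le> 1 / (1 + t)"
      using exp_ge_add_one_self[of t] assms by (simp add: exp_minus field_simps)
    then have "t / (1 + t) \<le> 1 - exp (- t)" using assms by (simp add: field_simps)
    then have "ln (t / (1 + t)) \<le> ln (1 - exp (- t))" using assms by (intro ln_mono) auto
    moreover have "ln (t / (1 + t)) = - ln (1 + 1 / t)"
    proof -
      have "1 + 1 / t = inverse (t / (1 + t))" using assms by (simp add: field_simps)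
      then show ?thesis using assms by (simp only: ln_inverse)
    qed
    ultimately show ?thesis by (simp add: nlog_def)
  qed
  then have "t * nlog t \<le> t * ln (1 + 1 / t)" using assms by (intro mult_left_mono) auto
  ultimately have "Phi t \<le> t * (Li2 1 + ln (1 + 1 / t))" by (simp add: Phi_def algebra_simps)
  then show ?thesis using assms by (simp add: field_simps)
qed

text \<open>
  The sum also lies above the integral from \<open>t\<close> to \<open>(k + 1) t\<close>. The missing piece near 0 is only logarithmic
  in \<open>t\<close>.
\<close>

lemma log_genfun_lower:
  assumes "t > 0" "k > 0"
  shows "Phi (real k * t) / t - (Li2 1 + ln (1 + 1 / t)) \<le> log_genfun k t"
proof -
  have "(Phi (t * real (Suc k)) - Phi t) / t \<le> log_genfun k t" for k
  proof (induction k)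
    case 0
    then show ?case by (simp add: log_genfun_def)
  next
    case (Suc k)
    have "Phi (t * real (Suc (Suc k))) - Phi (t * real (Suc k))
        \<le> (t * real (Suc (Suc k)) - t * real (Suc k)) * nlog (t * real (Suc k))"
      using assms by (intro Phi_diff) auto
    then have "(Phi (t * real (Suc (Suc k))) - Phi (t * real (Suc k))) / t \<le> nlog (t * real (Suc k))"
      using assms by (simp add: field_simps)
    then show ?case using Suc unfolding log_genfun_Suc by (simp add: diff_divide_distrib)
  qed
  from this[of k] have "Phi (t * real (Suc k)) / t - Phi t / t \<le> log_genfun k t"
    by (simp add: diff_divide_distrib)
  moreover have "Phi (real k * t) / t \<le> Phi (t * real (Suc k)) / t"
    using assms by (intro divide_right_mono Phi_mono) auto
  ultimately show ?thesis using Phi_over_arg[OF assms(1)] by linarith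
qed

text \<open>
  Write \<open>L x = Li2 (1 - exp (- x))\<close>. The derivative of \<open>L x / x\<^sup>2\<close> has the sign of
  \<open>R x = x\<^sup>2 / (exp x - 1) - 2 * L x\<close>. The function \<open>R\<close> is decreasing and tends to 0 at 0, so it is nonpositive.
\<close>

lemma Li2_exp_over_square_antimono:
  assumes "0 < x" "x \<le> y"
  shows "Li2 (1 - exp (- y)) / y\<^sup>2 \<le> Li2 (1 - exp (- x)) / x\<^sup>2"
proof -
  define L where "L = (\<lambda>x. Li2 (1 - exp (- x)))"
  have L: "(L has_real_derivative x / (exp x - 1)) (at x)" if "x > 0" for x
    unfolding L_def by (rule Li2_exp_has_derivative[OF that])
  have Lnn: "L x \<ge> 0" if "x > 0" for x unfolding L_def using that by (intro Li2_nonneg) auto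
  define R where "R = (\<lambda>x. x\<^sup>2 / (exp x - 1) - 2 * L x)"
  have Rder: "(R has_real_derivative - (x\<^sup>2 * exp x) / (exp x - 1)\<^sup>2) (at x)" if "x > 0" for x
  proof -
    define D where "D = exp x - 1"
    have ne: "D \<noteq> 0" using that by (simp add: D_def)
    have "(R has_real_derivative (2 * x * D - x\<^sup>2 * exp x) / (D * D) - 2 * (x / D)) (at x)"
      unfolding R_def D_def using ne[unfolded D_def]
      by (auto intro!: derivative_eq_intros L[OF that])
    moreover have "(2 * x * D - x\<^sup>2 * exp x) / (D * D) - 2 * (x / D) = - (x\<^sup>2 * exp x) / D\<^sup>2"
      using ne by (simp add: field_simps power2_eq_square)
    ultimately show ?thesis by (simp add: D_def)
  qed
  have R_le: "R b \<le> R a" if "0 < a" "a \<le> b" for a b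
  proof (rule DERIV_nonpos_imp_nonincreasing[OF that(2)])
    fix z assume "a \<le> z" "z \<le> b"
    then have "z > 0" using that by simp
    moreover have "- (z\<^sup>2 * exp z) / (exp z - 1)\<^sup>2 \<le> 0" by (simp add: divide_nonpos_nonneg)
    ultimately show "\<exists>D. (R has_real_derivative D) (at z) \<and> D \<le> 0" using Rder by blast
  qed
  have R_nonpos: "R x \<le> 0" if "x > 0" for x
  proof (rule field_le_epsilon)
    fix e :: real assume "e > 0"
    define a where "a = min e x"
    have a: "a > 0" "a \<le> x" "a \<le> e" using \<open>e > 0\<close> that by (auto simp: a_def)
    have "R x \<le> R a" using R_le a by blast
    also have "R a \<le> a\<^sup>2 / (exp a - 1)" using Lnn[of a] a by (simp add: R_def)
    also have "\<dots> \<le> a\<^sup>2 / a"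
      using exp_ge_add_one_self[of a] a by (intro divide_left_mono mult_pos_pos) (linarith | simp)+
    also have "\<dots> \<le> e" using a by (simp add: power2_eq_square)
    finally show "R x \<le> 0 + e" by simp
  qed
  have "L y / y\<^sup>2 \<le> L x / x\<^sup>2"
  proof (rule DERIV_nonpos_imp_nonincreasing[OF assms(2)])
    fix z assume z: "x \<le> z" "z \<le> y"
    then have zp: "z > 0" using assms by simp
    have "((\<lambda>z. L z / z\<^sup>2) has_real_derivative
        (z / (exp z - 1) * z\<^sup>2 - L z * (2 * z)) / (z\<^sup>2 * z\<^sup>2)) (at z)"
      using zp by (auto intro!: derivative_eq_intros L[OF zp])
    moreover have "z / (exp z - 1) * z\<^sup>2 - L z * (2 * z) = z * R z"
      by (simp add: R_def power2_eq_square algebra_simps)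
    moreover have "z * R z / (z\<^sup>2 * z\<^sup>2) \<le> 0"
      using R_nonpos[OF zp] zp by (simp add: divide_nonpos_pos mult_nonneg_nonpos)
    ultimately show "\<exists>D. ((\<lambda>z. L z / z\<^sup>2) has_real_derivative D) (at z) \<and> D \<le> 0" by auto
  qed
  then show ?thesis by (simp add: L_def)
qed

text \<open>
  Since the derivative of \<open>Phi x / x\<close> is \<open>- Li2 (1 - exp (- x)) / x\<^sup>2\<close>, the preceding lemma says that
  \<open>Phi x / x\<close> is convex. The claim is the tangent inequality at \<open>T\<close>, multiplied by \<open>T\<close>.
\<close>

lemma Phi_scaled_tangent:
  assumes x: "0 < x" and T: "0 < T"
  shows "2 * Li2 (1 - exp (- T)) + T * nlog T \<le> x / T * Li2 (1 - exp (- T)) + T * Phi x / x"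
proof -
  define A where "A = Li2 (1 - exp (- T))"
  define E where "E = (\<lambda>x. x / T * A + T * Phi x / x)"
  have der: "(E has_real_derivative T * (A / T\<^sup>2 - Li2 (1 - exp (- z)) / z\<^sup>2)) (at z)" if z: "z > 0" for z
  proof -
    have "(E has_real_derivative A / T + (T * nlog z * z - T * Phi z) / (z * z)) (at z)"
      unfolding E_def using z T
      by (auto intro!: derivative_eq_intros Phi_has_derivative simp: field_simps)
    moreover have "A / T + (T * nlog z * z - T * Phi z) / (z * z) = T * (A / T\<^sup>2 - Li2 (1 - exp (- z)) / z\<^sup>2)"
      using z T by (simp add: Phi_def field_simps power2_eq_square)
    ultimately show ?thesis by simp
  qed
  have "E T \<le> E x"
  proof (cases "x \<le> T")
    case True
    show ?thesis
    proof (rule DERIV_nonpos_imp_nonincreasing[OF True])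
      fix z assume z: "x \<le> z" "z \<le> T"
      have "T * (A / T\<^sup>2 - Li2 (1 - exp (- z)) / z\<^sup>2) \<le> 0"
        using Li2_exp_over_square_antimono[of z T] z x T by (simp add: A_def mult_nonneg_nonpos)
      then show "\<exists>D. (E has_real_derivative D) (at z) \<and> D \<le> 0" using der[of z] z x by auto
    qed
  next
    case False
    then have Tx: "T \<le> x" by simp
    show ?thesis
    proof (rule DERIV_nonneg_imp_nondecreasing[OF Tx])
      fix z assume z: "T \<le> z" "z \<le> x"
      have "T * (A / T\<^sup>2 - Li2 (1 - exp (- z)) / z\<^sup>2) \<ge> 0"
        using Li2_exp_over_square_antimono[of T z] z x T by (simp add: A_def)
      then show "\<exists>D. (E has_real_derivative D) (at z) \<and> D \<ge> 0" using der[of z] z T by auto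
    qed
  qed
  moreover have "E T = 2 * A + T * nlog T" using T by (simp add: E_def Phi_def A_def)
  ultimately show ?thesis by (simp add: E_def A_def)
qed

text \<open>
  \<open>P\<close> is the limit of \<^const>\<open>Phi\<close> at infinity. It lies between the increasing function
  \<open>Phi x + exp (- x)\<close> and the decreasing function \<open>Phi x + 2 * exp (- x)\<close>, by the corresponding
  bounds on \<^const>\<open>nlog\<close>.
\<close>

lemma Phi_limit:
  obtains P where "P > 0" "\<And>x. x > 0 \<Longrightarrow> Phi x + exp (- x) \<le> P"
    "\<And>x. x \<ge> 1 \<Longrightarrow> P \<le> Phi x + 2 * exp (- x)"
proof -
  define f1 f2 where "f1 = (\<lambda>x. Phi x + exp (- x))" and "f2 = (\<lambda>x. Phi x + 2 * exp (- x))"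
  have nl1: "exp (- x) \<le> nlog x" if "x > 0" for x
    using ln_le_minus_one[of "1 - exp (- x)"] that by (simp add: nlog_def)
  have nl2: "nlog x \<le> 2 * exp (- x)" if "x \<ge> 1" for x
  proof -
    define y where "y = exp (- x)"
    have "2 \<le> exp x" using exp_ge_add_one_self[of x] that by linarith
    then have "y \<le> 1 / 2" by (simp add: y_def exp_minus field_simps)
    moreover have "y \<ge> 0" by (simp add: y_def)
    ultimately have "- y - 2 * y\<^sup>2 \<le> ln (1 - y)" "y * y \<le> 1 / 2 * y"
      by (intro ln_one_minus_pos_lower_bound mult_right_mono; simp)+
    then show ?thesis unfolding nlog_def y_def[symmetric] power2_eq_square by linarith
  qed
  have m1: "f1 a \<le> f1 b" if "0 < a" "a \<le> b" for a b
  proof (rule DERIV_nonneg_imp_nondecreasing[OF that(2)])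
    fix z assume "a \<le> z" "z \<le> b"
    then have z: "z > 0" using that by simp
    have "(f1 has_real_derivative nlog z - exp (- z)) (at z)"
      unfolding f1_def using z by (auto intro!: derivative_eq_intros Phi_has_derivative)
    then show "\<exists>D. (f1 has_real_derivative D) (at z) \<and> D \<ge> 0" using nl1[OF z] by auto
  qed
  have m2: "f2 b \<le> f2 a" if "1 \<le> a" "a \<le> b" for a b
  proof (rule DERIV_nonpos_imp_nonincreasing[OF that(2)])
    fix z assume "a \<le> z" "z \<le> b"
    then have z: "z \<ge> 1" using that by simp
    have "(f2 has_real_derivative nlog z - 2 * exp (- z)) (at z)"
      unfolding f2_def using z by (auto intro!: derivative_eq_intros Phi_has_derivative)
    then show "\<exists>D. (f2 has_real_derivative D) (at z) \<and> D \<le> 0" using nl2[OF z] by auto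
  qed
  have f12: "f1 x \<le> f2 y" if "x \<ge> 1" "y \<ge> 1" for x y
  proof -
    have "f1 x \<le> f1 (max x y)" using that by (intro m1) auto
    also have "\<dots> \<le> f2 (max x y)" by (simp add: f1_def f2_def)
    also have "\<dots> \<le> f2 y" using that by (intro m2) auto
    finally show ?thesis .
  qed
  define P where "P = (SUP x\<in>{1..}. f1 x)"
  have bdd: "bdd_above (f1 ` {1..})" using f12[of _ 1] by (intro bdd_aboveI2[of _ _ "f2 1"]) auto
  have le: "f1 x \<le> P" if "x > 0" for x
  proof -
    have "f1 x \<le> f1 (max x 1)" using that by (intro m1) auto
    also have "\<dots> \<le> P" unfolding P_def by (rule cSUP_upper[OF _ bdd]) auto
    finally show ?thesis .
  qed
  have ge: "P \<le> f2 x" if "x \<ge> 1" for x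
    unfolding P_def using f12 that by (intro cSUP_least) auto
  have "f1 1 > 0"
    using Li2_nonneg[of "1 - exp (- 1)"] nlog_nonneg[of 1] by (simp add: f1_def Phi_def add_nonneg_pos)
  then have "P > 0" using le[of 1] by simp
  with le ge show ?thesis using that[of P] by (simp add: f1_def f2_def)
qed

section \<open>From counting bounds to probabilities\<close>

lemma limsup_ext_ln_neg:
  fixes p :: "nat \<Rightarrow> real"
  assumes c: "c > 0" and ev: "\<forall>\<^sub>F n in sequentially. p n \<le> exp (- (c * real n powr \<delta>))"
    and nonneg: "\<And>n. p n \<ge> 0"
  shows "limsup (\<lambda>n. ereal (real n powr (- \<delta>)) * ext_ln (p n)) < 0"
proof -
  have "\<forall>\<^sub>F n in sequentially. ereal (real n powr (- \<delta>)) * ext_ln (p n) \<le> ereal (- c)"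
    using ev eventually_gt_at_top[of 0]
  proof eventually_elim
    case (elim n)
    have pos: "real n powr (- \<delta>) > 0" using elim by simp
    show ?case
    proof (cases "p n = 0")
      case True
      then show ?thesis using pos by (simp add: ext_ln_def)
    next
      case False
      then have "p n > 0" using nonneg[of n] by simp
      then have "ln (p n) \<le> ln (exp (- (c * real n powr \<delta>)))" using elim by (subst ln_le_cancel_iff) auto
      then have "ln (p n) \<le> - (c * real n powr \<delta>)" by simp
      then have "real n powr (- \<delta>) * ln (p n) \<le> real n powr (- \<delta>) * - (c * real n powr \<delta>)"
        using pos by (intro mult_left_mono) auto
      also have "\<dots> = - c" using elim by (simp add: powr_minus field_simps)
      finally show ?thesis using False by (simp add: ext_ln_def)
    qed
  qed
  then have "limsup (\<lambda>n. ereal (real n powr (- \<delta>)) * ext_ln (p n)) \<le> ereal (- c)"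
    by (rule Limsup_bounded)
  also have "\<dots> < 0" using c by simp
  finally show ?thesis .
qed

lemma le_min_weight:
  assumes "gap_sequence qs"
  shows "k \<le> min_weight qs k"
proof -
  have "1 \<le> gap_sum qs j" if "j \<in> {1..k}" for j
  proof -
    have "qs 0 \<le> gap_sum qs j" unfolding gap_sum_def using that by (intro member_le_sum) auto
    then show ?thesis using assms by (simp add: gap_sequence_def)
  qed
  then have "(\<Sum>j=1..k. 1) \<le> min_weight qs k" unfolding min_weight_def by (rule sum_mono)
  then show ?thesis by simp
qed

text \<open>
  Only one value \<open>k0\<close> is kept in the denominator. The numerator has at most \<open>n\<close> nonzero terms, because
  \<open>k \<le> min_weight qs k\<close>, and \<open>k = 0\<close> would force \<open>n = 0\<close>.
\<close>

lemma gap_prob_le: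
  assumes qs: "gap_sequence qs" and n: "n \<ge> qs 0"
    and k0: "min_weight qs k0 \<le> n" "exp A \<le> real (pcount k0 (n - min_weight qs k0))"
    and bad: "\<And>k. k > 0 \<Longrightarrow> min_weight qs k \<le> n \<Longrightarrow> Bad k \<Longrightarrow>
       real (pcount k (n - min_weight qs k)) \<le> exp B"
  shows "measure_pmf.prob (gap_measure qs n) {l \<in> gap_partitions_of qs n. Bad (num_parts l)}
     \<le> real n * exp (B - A)"
proof -
  let ?S = "gap_partitions_of qs n" and ?F = "\<lambda>k. {l \<in> gap_partitions_of qs n. num_parts l = k}"
  have npos: "n > 0" using qs n by (simp add: gap_sequence_def)
  have fin: "finite ?S" by (rule finite_gap_partitions_of)
  note cardF = card_gap_partitions_with_parts[OF qs]
  have "{l \<in> ?S. Bad (num_parts l)} \<subseteq> (\<Union>k\<in>{k\<in>{1..n}. Bad k \<and> min_weight qs k \<le> n}. ?F k)"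
  proof
    fix l assume l: "l \<in> {l \<in> ?S. Bad (num_parts l)}"
    define k where "k = num_parts l"
    have "?F k \<noteq> {}" using l by (auto simp: k_def)
    then have "card (?F k) \<noteq> 0" using fin by simp
    then have mw: "min_weight qs k \<le> n" "pcount k (n - min_weight qs k) \<noteq> 0"
      by (auto simp: cardF split: if_splits)
    then have "k > 0" using npos by (cases "k = 0") (auto simp: pcount_0 min_weight_def)
    moreover have "k \<le> n" using le_min_weight[OF qs, of k] mw by simp
    ultimately show "l \<in> (\<Union>k\<in>{k\<in>{1..n}. Bad k \<and> min_weight qs k \<le> n}. ?F k)"
      using l mw by (auto simp: k_def)
  qed
  then have "card {l \<in> ?S. Bad (num_parts l)} \<le> card (\<Union>k\<in>{k\<in>{1..n}. Bad k \<and> min_weight qs k \<le> n}. ?F k)"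
    using fin by (intro card_mono finite_UN_I) auto
  also have "\<dots> \<le> (\<Sum>k\<in>{k\<in>{1..n}. Bad k \<and> min_weight qs k \<le> n}. card (?F k))"
    by (rule card_UN_le) simp
  finally have "real (card {l \<in> ?S. Bad (num_parts l)})
     \<le> (\<Sum>k\<in>{k\<in>{1..n}. Bad k \<and> min_weight qs k \<le> n}. real (card (?F k)))"
    by (simp flip: of_nat_sum)
  also have "\<dots> \<le> (\<Sum>k\<in>{k\<in>{1..n}. Bad k \<and> min_weight qs k \<le> n}. exp B)"
    using bad by (intro sum_mono) (auto simp: cardF)
  also have "\<dots> \<le> (\<Sum>k\<in>{1..n}. exp B)" by (intro sum_mono2) auto
  finally have num: "real (card {l \<in> ?S. Bad (num_parts l)}) \<le> real n * exp B" by simp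
  have "card (?F k0) \<le> card ?S" using fin by (intro card_mono) auto
  then have den: "exp A \<le> real (card ?S)" using k0 by (simp add: cardF)
  have "measure_pmf.prob (gap_measure qs n) {l \<in> ?S. Bad (num_parts l)}
      = real (card {l \<in> ?S. Bad (num_parts l)}) / real (card ?S)"
    unfolding gap_measure_def using gap_partitions_of_nonempty[OF qs n] fin
    by (subst measure_pmf_of_set) (auto intro!: arg_cong[where f = card])
  also have "\<dots> \<le> (real n * exp B) / exp A" using num den by (intro frac_le) auto
  finally show ?thesis by (simp add: exp_diff)
qed

lemma gap_limsup_neg:
  fixes S :: "nat \<Rightarrow> real"
  assumes qs: "gap_sequence qs" and c: "c > 0" and D: "D \<ge> 0" and \<rho>: "0 < \<rho>" "\<rho> < \<delta>"
    and lower: "\<forall>\<^sub>F n in sequentially. \<exists>k. min_weight qs k \<le> n \<and>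
        exp (S n - D * real n powr \<rho>) \<le> real (pcount k (n - min_weight qs k))"
    and upper: "\<forall>\<^sub>F n in sequentially. \<forall>k. k > 0 \<and> min_weight qs k \<le> n \<and> Bad n k \<longrightarrow>
        real (pcount k (n - min_weight qs k)) \<le> exp (S n - c * real n powr \<delta> + D * real n powr \<rho>)"
  shows "limsup (\<lambda>n. ereal (real n powr (- \<delta>)) *
     ext_ln (measure_pmf.prob (gap_measure qs n) {l \<in> gap_partitions_of qs n. Bad n (num_parts l)})) < 0"
proof (rule limsup_ext_ln_neg[of "c / 2"])
  define D' where "D' = 2 * D + 1"
  have D': "D' > 0" "D' \<ge> 2 * D" using D by (auto simp: D'_def)
  have "\<forall>\<^sub>F n in sequentially. ln (real n) + D' * real n powr \<rho> \<le> c / 2 * real n powr \<delta>"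
    using c D' \<rho> by real_asymp
  then show "\<forall>\<^sub>F n in sequentially.
     measure_pmf.prob (gap_measure qs n) {l \<in> gap_partitions_of qs n. Bad n (num_parts l)}
       \<le> exp (- (c / 2 * real n powr \<delta>))"
    using lower upper eventually_ge_at_top[of "qs 0"] eventually_gt_at_top[of 0]
  proof eventually_elim
    case (elim n)
    then obtain k0 where k0: "min_weight qs k0 \<le> n"
      "exp (S n - D * real n powr \<rho>) \<le> real (pcount k0 (n - min_weight qs k0))" by blast
    have "measure_pmf.prob (gap_measure qs n) {l \<in> gap_partitions_of qs n. Bad n (num_parts l)}
       \<le> real n * exp ((S n - c * real n powr \<delta> + D * real n powr \<rho>) - (S n - D * real n powr \<rho>))"
      using elim by (intro gap_prob_le[OF qs _ k0]) auto
    also have "\<dots> = exp (ln (real n) + ((S n - c * real n powr \<delta> + D * real n powr \<rho>) - (S n - D * real n powr \<rho>)))"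
      using elim(5) by (simp only: exp_add exp_ln of_nat_0_less_iff)
    also have "\<dots> \<le> exp (- (c / 2 * real n powr \<delta>))"
    proof -
      have "2 * D * real n powr \<rho> \<le> D' * real n powr \<rho>" using D' by (intro mult_right_mono) auto
      then show ?thesis using elim(1) by simp
    qed
    finally show ?case .
  qed
qed (use c in auto)

lemma min_weight_estimate:
  fixes q \<beta> :: real
  assumes q: "q \<ge> 0" and \<beta>: "0 \<le> \<beta>"
    and Q: "(\<lambda>k. real (\<Sum>i<k. qs i) - q * real k) \<in> O(\<lambda>k. real k powr \<beta>)"
  obtains C where "C \<ge> 0" "\<And>k. \<bar>real (min_weight qs k) - q * (real k)\<^sup>2 / 2\<bar> \<le> C * real k powr (1 + \<beta>)"
proof -
  define f where "f = (\<lambda>k. \<bar>real (gap_sum qs k) - q * real k\<bar>)"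
  obtain c where c: "c > 0" "\<forall>\<^sub>F k in sequentially. f k \<le> c * real k powr \<beta>"
    using Q unfolding f_def gap_sum_def by (elim landau_o.bigE) auto
  then obtain N where N: "\<And>k. k \<ge> N \<Longrightarrow> f k \<le> c * real k powr \<beta>"
    by (auto simp: eventually_sequentially)
  define C0 where "C0 = c + (\<Sum>j<N. f j)"
  have f0: "f j \<ge> 0" for j by (simp add: f_def)
  have C0: "C0 \<ge> 0" "C0 \<ge> c" using c f0 by (auto simp: C0_def intro!: add_nonneg_nonneg sum_nonneg)
  have bound: "f j \<le> C0 * real j powr \<beta>" if "j \<ge> 1" for j
  proof (cases "j \<ge> N")
    case True
    have "f j \<le> c * real j powr \<beta>" using N True by simp
    also have "\<dots> \<le> C0 * real j powr \<beta>" using C0 by (intro mult_right_mono) auto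
    finally show ?thesis .
  next
    case False
    have "f j \<le> (\<Sum>j<N. f j)" using f0 False by (intro member_le_sum) auto
    also have "\<dots> \<le> C0" using c by (simp add: C0_def)
    also have "\<dots> \<le> C0 * real j powr \<beta>"
      using that \<beta> C0 ge_one_powr_ge_zero[of "real j" \<beta>] by (simp add: mult_le_cancel_left1)
    finally show ?thesis .
  qed
  show ?thesis
  proof (rule that[of "C0 + q"])
    show "C0 + q \<ge> 0" using C0 q by simp
    fix k
    show "\<bar>real (min_weight qs k) - q * (real k)\<^sup>2 / 2\<bar> \<le> (C0 + q) * real k powr (1 + \<beta>)"
    proof (cases "k = 0")
      case True
      then show ?thesis by (simp add: min_weight_def)
    next
      case False
      have gauss: "(\<Sum>j=1..k. real j) = real k * (real k + 1) / 2" for k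
        by (induction k) (auto simp: field_simps)
      have "(\<Sum>j=1..k. q * real j) = q * (real k * (real k + 1) / 2)"
        by (simp only: sum_distrib_left[symmetric] gauss)
      then have "real (min_weight qs k) - q * (real k * (real k + 1) / 2) = (\<Sum>j=1..k. real (gap_sum qs j) - q * real j)"
        by (simp add: min_weight_def sum_subtractf)
      also have "\<bar>\<dots>\<bar> \<le> (\<Sum>j=1..k. f j)" unfolding f_def by (rule sum_abs)
      also have "\<dots> \<le> (\<Sum>j=1..k. C0 * real k powr \<beta>)"
      proof (rule sum_mono)
        fix j assume j: "j \<in> {1..k}"
        have "f j \<le> C0 * real j powr \<beta>" using bound j by simp
        also have "\<dots> \<le> C0 * real k powr \<beta>" using j C0 \<beta> by (intro mult_left_mono powr_mono2) auto
        finally show "f j \<le> C0 * real k powr \<beta>" .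
      qed
      also have "\<dots> = C0 * real k powr (1 + \<beta>)" using False by (simp add: powr_add)
      finally have 1: "\<bar>real (min_weight qs k) - q * (real k * (real k + 1) / 2)\<bar> \<le> C0 * real k powr (1 + \<beta>)" .
      have "real k = real k powr 1" using False by simp
      also have "\<dots> \<le> real k powr (1 + \<beta>)" using False \<beta> by (intro powr_mono) auto
      finally have "q * real k \<le> q * real k powr (1 + \<beta>)" using q by (rule mult_left_mono)
      moreover have "q * (real k * (real k + 1) / 2) = q * (real k)\<^sup>2 / 2 + q * real k / 2"
        by (simp add: field_simps power2_eq_square)
      moreover have "q * real k / 2 \<ge> 0" using q by simp
      ultimately show ?thesis using 1 unfolding distrib_right by linarith
    qed
  qed
qed

section \<open>The exponent for positive mean gap\<close>

lemma T_const_properties: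
  assumes "q > 0"
  shows "T_const q > 0" "nlog (T_const q) = q * T_const q"
proof -
  have *: "T_const q > 0 \<and> exp (- q * T_const q) = 1 - exp (- T_const q)"
    using theI'[OF T_const_ex1[OF assms]] by (simp add: T_const_def)
  then show "T_const q > 0" by simp
  have "nlog (T_const q) = - ln (exp (- q * T_const q))" using * by (simp add: nlog_def)
  then show "nlog (T_const q) = q * T_const q" by simp
qed

text \<open>
  The left-hand side is the value of the right-hand side at \<open>t = \<theta> / r\<close>, its minimum over \<open>t\<close>. With
  \<open>r = sqrt n\<close>, the factor \<open>Li2 (1 - exp (- T)) / \<theta>\<^sup>2 * r\<^sup>2\<close> is what remains of \<open>n\<close> after
  subtracting \<open>q * k\<^sup>2 / 2\<close> for \<open>k = T * r / \<theta>\<close>.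
\<close>

lemma saddle_exponent_ge:
  fixes q :: real
  assumes q: "q > 0" and r: "r > 0" and t: "t > 0"
  defines "T \<equiv> T_const q" and "\<theta> \<equiv> theta_const q"
  shows "2 * \<theta> * r \<le> t * (Li2 (1 - exp (- T)) / \<theta>\<^sup>2 * r\<^sup>2) + Phi (T * r / \<theta> * t) / t"
proof -
  define A where "A = Li2 (1 - exp (- T))"
  have T: "T > 0" "nlog T = q * T" using T_const_properties[OF q] by (auto simp: T_def)
  have th: "\<theta> > 0" "\<theta>\<^sup>2 = q * T\<^sup>2 / 2 + A"
    using theta_const[OF q] by (auto simp: \<theta>_def T_def A_def)
  define x where "x = T * r / \<theta> * t"
  have x: "x > 0" using T th r t by (simp add: x_def)
  have "2 * \<theta>\<^sup>2 = 2 * A + T * nlog T"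
    unfolding th(2) T(2) by (simp add: power2_eq_square)
  also have "\<dots> \<le> x / T * A + T * Phi x / x"
    unfolding A_def by (rule Phi_scaled_tangent[OF x T(1)])
  finally have "r / \<theta> * (2 * \<theta>\<^sup>2) \<le> r / \<theta> * (x / T * A + T * Phi x / x)"
    using r th by (intro mult_left_mono) auto
  moreover have "r / \<theta> * (2 * \<theta>\<^sup>2) = 2 * \<theta> * r" using th(1) by (simp add: power2_eq_square)
  moreover have "r / \<theta> * (x / T * A) = t * (A / \<theta>\<^sup>2 * r\<^sup>2)"
    using T th by (simp add: x_def power2_eq_square)
  moreover have "r / \<theta> * (T * Phi x / x) = Phi x / t"
  proof -
    have "r / \<theta> * (T * Phi x / x) = Phi x * (r * T / (\<theta> * x))" by simp
    also have "r * T / (\<theta> * x) = 1 / t" using T th r t by (simp add: x_def)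
    finally show ?thesis by simp
  qed
  ultimately show ?thesis by (simp only: distrib_left x_def[symmetric] A_def[symmetric])
qed

text \<open>
  Bounding \<^const>\<open>Phi\<close> by its tangent at \<open>T\<close>, whose slope is \<open>q * T\<close>, and completing the square.
\<close>

lemma saddle_exponent_le:
  fixes q :: real
  assumes q: "q > 0" and r: "r > 0" and k: "k > 0"
  defines "T \<equiv> T_const q" and "\<theta> \<equiv> theta_const q"
  defines "t \<equiv> \<theta> / r"
  shows "t * (r\<^sup>2 - q * k\<^sup>2 / 2) + Phi (k * t) / t
     \<le> 2 * \<theta> * r - q * \<theta> / 2 * (k - T * r / \<theta>)\<^sup>2 / r"
proof -
  define A where "A = Li2 (1 - exp (- T))"
  have T: "T > 0" "nlog T = q * T" using T_const_properties[OF q] by (auto simp: T_def)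
  have th: "\<theta> > 0" "\<theta>\<^sup>2 = q * T\<^sup>2 / 2 + A"
    using theta_const[OF q] by (auto simp: \<theta>_def T_def A_def)
  have t: "t > 0" using th r by (simp add: t_def)
  have "Phi (k * t) \<le> Phi T + q * T * (k * t - T)"
    using Phi_tangent[of "k * t" T] k t T by simp
  also have "Phi T = A + q * T\<^sup>2" by (simp add: Phi_def A_def T(2) power2_eq_square)
  also have "A + q * T\<^sup>2 + q * T * (k * t - T) = \<theta>\<^sup>2 + q * (k * t)\<^sup>2 / 2 - q / 2 * (k * t - T)\<^sup>2"
    unfolding th(2) by (simp add: power2_eq_square field_simps)
  finally have "Phi (k * t) / t \<le> (\<theta>\<^sup>2 + q * (k * t)\<^sup>2 / 2 - q / 2 * (k * t - T)\<^sup>2) / t"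
    using t by (intro divide_right_mono) auto
  also have "\<dots> = \<theta> * r + t * (q * k\<^sup>2 / 2) - q / 2 * ((k * t - T)\<^sup>2 / t)"
    using th(1) r by (simp add: t_def field_simps power2_eq_square)
  also have "k * t - T = t * (k - T * r / \<theta>)" using th r by (simp add: t_def field_simps)
  also have "(t * (k - T * r / \<theta>))\<^sup>2 / t = \<theta> * (k - T * r / \<theta>)\<^sup>2 / r"
    using t by (simp add: power_mult_distrib) (simp add: power2_eq_square t_def)
  finally have "Phi (k * t) / t \<le> \<theta> * r + t * (q * k\<^sup>2 / 2) - q / 2 * (\<theta> * (k - T * r / \<theta>)\<^sup>2 / r)" .
  moreover have "t * r\<^sup>2 = \<theta> * r" using r by (simp add: t_def power2_eq_square)
  ultimately show ?thesis by (simp add: right_diff_distrib)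
qed

text \<open>
  The number of parts is taken to be \<open>T * sqrt n / \<theta>\<close> rounded up. Rounding and the error in
  \<^const>\<open>min_weight\<close> change the remaining weight by \<open>O(n powr ((1 + \<beta>) / 2))\<close>, hence the exponent by
  \<open>O(n powr (\<beta> / 2))\<close>, as the tilt has order \<open>1 / sqrt n\<close>.
\<close>

lemma gap_lower_positive:
  fixes q \<beta> \<rho> C :: real
  assumes q: "q > 0" and \<beta>: "0 \<le> \<beta>" "\<beta> < 1" and \<rho>: "0 < \<rho>" "\<beta> / 2 \<le> \<rho>" and C: "C \<ge> 0"
    and mw: "\<And>k. \<bar>real (min_weight qs k) - q * (real k)\<^sup>2 / 2\<bar> \<le> C * real k powr (1 + \<beta>)"
  shows "\<exists>D\<ge>0. \<forall>\<^sub>F n in sequentially. \<exists>k. min_weight qs k \<le> n \<and>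
     exp (2 * theta_const q * sqrt (real n) - D * real n powr \<rho>) \<le> real (pcount k (n - min_weight qs k))"
proof -
  define T \<theta> where "T = T_const q" and "\<theta> = theta_const q"
  define A where "A = Li2 (1 - exp (- T))"
  have T: "T > 0" using T_const_properties[OF q] by (auto simp: T_def)
  have th: "\<theta> > 0" "\<theta>\<^sup>2 = q * T\<^sup>2 / 2 + A"
    using theta_const[OF q] by (auto simp: \<theta>_def T_def A_def)
  have A: "A > 0" unfolding A_def using T by (intro Li2_pos) auto
  define a \<kappa> where "a = T / \<theta>" and "\<kappa> = A / \<theta>\<^sup>2"
  have a: "a > 0" and \<kappa>: "\<kappa> > 0" using T th(1) A by (auto simp: a_def \<kappa>_def)
  define c where "c = min 1 a"
  have c: "0 < c" "c \<le> 1" "c \<le> a" using a by (auto simp: c_def)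
  obtain C' where C': "C' \<ge> 0" and evm: "\<forall>\<^sub>F m in sequentially. \<forall>k. c * sqrt (real m) \<le> real k \<and> real k \<le> real m powr (1/2 + \<rho>/2) \<longrightarrow>
     (\<exists>t. c / (8 * sqrt (real m)) \<le> t \<and> t \<le> 4 / sqrt (real m) \<and>
       exp (t * real m + log_genfun k t - C' * real m powr (2 * (\<rho>/2))) \<le> real (pcount k m))"
    using pcount_lower_bound[OF c(1,2), of "\<rho>/2"] \<rho> by auto
  then obtain M where M: "\<And>m k. m \<ge> M \<Longrightarrow> c * sqrt (real m) \<le> real k \<Longrightarrow> real k \<le> real m powr (1/2 + \<rho>/2) \<Longrightarrow>
     \<exists>t. c / (8 * sqrt (real m)) \<le> t \<and> t \<le> 4 / sqrt (real m) \<and>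
       exp (t * real m + log_genfun k t - C' * real m powr \<rho>) \<le> real (pcount k m)"
    by (auto simp: eventually_sequentially)
  define D1 where "D1 = q * (2 * a + 1) / 2 + C * (a + 1) powr (1 + \<beta>)"
  have D1: "D1 > 0" unfolding D1_def using q a C by (intro add_pos_nonneg) auto
  define D2 where "D2 = 4 * D1 / sqrt (\<kappa> / 2)"
  have D2: "D2 > 0" using D1 \<kappa> by (simp add: D2_def)
  define L1 where "L1 = Li2 1"
  have ev: "\<forall>\<^sub>F n in sequentially. n \<ge> 1 \<and> D1 * real n powr ((1 + \<beta>) / 2) \<le> \<kappa> / 2 * real n
      \<and> (a + 1) * sqrt (real n) \<le> (\<kappa> / 2 * real n) powr (1/2 + \<rho>/2)
      \<and> L1 + ln (1 + 8 / c * sqrt (real n)) \<le> real n powr \<rho>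
      \<and> real M \<le> \<kappa> / 2 * real n"
    using D1 \<beta> \<kappa> a \<rho> c by (intro eventually_conj) real_asymp+
  have "\<forall>\<^sub>F n in sequentially. \<exists>k. min_weight qs k \<le> n \<and>
     exp (2 * \<theta> * sqrt (real n) - (D2 + 1 + C') * real n powr \<rho>) \<le> real (pcount k (n - min_weight qs k))"
    using ev
  proof (eventually_elim, elim conjE)
    fix n :: nat
    assume n: "n \<ge> 1"
      and e1: "D1 * real n powr ((1 + \<beta>) / 2) \<le> \<kappa> / 2 * real n"
      and e2: "(a + 1) * sqrt (real n) \<le> (\<kappa> / 2 * real n) powr (1/2 + \<rho>/2)"
      and e3: "L1 + ln (1 + 8 / c * sqrt (real n)) \<le> real n powr \<rho>"
      and e4: "real M \<le> \<kappa> / 2 * real n"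
    define r where "r = sqrt (real n)"
    have r: "r \<ge> 1" "r\<^sup>2 = real n" "r = real n powr (1/2)"
      using n by (auto simp: r_def powr_half_sqrt)
    define k where "k = nat \<lceil>a * r\<rceil>"
    have ar: "a * r > 0" using a r(1) by simp
    have k: "a * r \<le> real k" "real k \<le> a * r + 1" using ar by (auto simp: k_def)
    have kpos: "k > 0" using k ar by (cases k) auto
    have kr: "real k \<le> (a + 1) * r" using k r by (simp add: distrib_right)
    have split: "real n powr ((1 + \<beta>) / 2) = r * real n powr (\<beta> / 2)"
      unfolding r(3) by (simp add: add_divide_distrib flip: powr_add)
    have rpow: "r powr (1 + \<beta>) = real n powr ((1 + \<beta>) / 2)"
      unfolding r(3) by (simp add: powr_powr)
    have "1 \<le> real n powr (\<beta> / 2)" using n \<beta> by (intro ge_one_powr_ge_zero) auto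
    then have r_le: "r \<le> real n powr ((1 + \<beta>) / 2)" unfolding split using r(1) by (simp add: mult_le_cancel_left1)
    have mwk: "real (min_weight qs k) \<le> real n - \<kappa> * real n + D1 * real n powr ((1 + \<beta>) / 2)"
    proof -
      have "real (min_weight qs k) \<le> q * (real k)\<^sup>2 / 2 + C * real k powr (1 + \<beta>)"
        using mw[of k] by linarith
      also have "\<dots> \<le> q * ((a * r)\<^sup>2 + (2 * a + 1) * r) / 2 + C * ((a + 1) * r) powr (1 + \<beta>)"
      proof (intro add_mono divide_right_mono mult_left_mono powr_mono2)
        have "(real k)\<^sup>2 \<le> (a * r + 1)\<^sup>2" using k by (intro power_mono) auto
        also have "\<dots> \<le> (a * r)\<^sup>2 + (2 * a + 1) * r" using r by (simp add: power2_eq_square algebra_simps)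
        finally show "(real k)\<^sup>2 \<le> (a * r)\<^sup>2 + (2 * a + 1) * r" .
      qed (use q C \<beta> kr in auto)
      also have "\<dots> = q * a\<^sup>2 / 2 * r\<^sup>2 + q * (2 * a + 1) / 2 * r + C * (a + 1) powr (1 + \<beta>) * real n powr ((1 + \<beta>) / 2)"
      proof -
        have "((a + 1) * r) powr (1 + \<beta>) = (a + 1) powr (1 + \<beta>) * real n powr ((1 + \<beta>) / 2)"
          using a r(1) by (simp add: powr_mult flip: rpow)
        then show ?thesis by (simp only:) (simp add: power_mult_distrib algebra_simps add_divide_distrib)
      qed
      also have "\<dots> \<le> q * a\<^sup>2 / 2 * r\<^sup>2 + q * (2 * a + 1) / 2 * real n powr ((1 + \<beta>) / 2)
          + C * (a + 1) powr (1 + \<beta>) * real n powr ((1 + \<beta>) / 2)"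
        using r_le q a C by (intro add_mono mult_left_mono) auto
      also have "q * a\<^sup>2 / 2 = 1 - \<kappa>"
      proof -
        have "q * a\<^sup>2 / 2 = (q * T\<^sup>2 / 2) / \<theta>\<^sup>2" by (simp add: a_def power_divide)
        also have "q * T\<^sup>2 / 2 = \<theta>\<^sup>2 - A" using th(2) by simp
        also have "(\<theta>\<^sup>2 - A) / \<theta>\<^sup>2 = 1 - \<kappa>" using th(1) by (simp add: \<kappa>_def diff_divide_distrib)
        finally show ?thesis .
      qed
      finally show ?thesis by (simp add: D1_def r(2) algebra_simps)
    qed
    then have mwn: "min_weight qs k \<le> n" and mlow: "\<kappa> / 2 * real n \<le> real n - real (min_weight qs k)"
    proof -
      have "0 \<le> \<kappa> / 2 * real n" using \<kappa> by simp
      then have "real (min_weight qs k) \<le> real n" using mwk e1 by linarith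
      then show "min_weight qs k \<le> n" by simp
      show "\<kappa> / 2 * real n \<le> real n - real (min_weight qs k)" using mwk e1 by linarith
    qed
    define m where "m = n - min_weight qs k"
    have m: "real m = real n - real (min_weight qs k)" "m \<le> n" using mwn by (auto simp: m_def of_nat_diff)
    have mlow': "\<kappa> / 2 * real n \<le> real m" using mlow m by simp
    have \<kappa>n: "\<kappa> / 2 * real n > 0" using \<kappa> n by simp
    have "m \<ge> M" using e4 mlow' by linarith
    moreover have sm: "sqrt (real m) \<le> r" unfolding r_def using m by simp
    have "c * sqrt (real m) \<le> a * r" using c sm by (intro mult_mono) auto
    then have "c * sqrt (real m) \<le> real k" using k by linarith
    moreover have "real k \<le> real m powr (1/2 + \<rho>/2)"
    proof -
      have "real k \<le> (\<kappa> / 2 * real n) powr (1/2 + \<rho>/2)" using kr e2 by (simp add: r_def)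
      also have "\<dots> \<le> real m powr (1/2 + \<rho>/2)" using mlow' \<kappa>n \<rho> by (intro powr_mono2) auto
      finally show ?thesis .
    qed
    ultimately obtain t where t: "c / (8 * sqrt (real m)) \<le> t" "t \<le> 4 / sqrt (real m)"
      "exp (t * real m + log_genfun k t - C' * real m powr \<rho>) \<le> real (pcount k m)" using M by blast
    have mpos: "real m > 0" using mlow' \<kappa>n by linarith
    have tpos: "t > 0"
    proof -
      have "0 < c / (8 * sqrt (real m))" using c mpos by simp
      then show ?thesis using t(1) by linarith
    qed
    have main: "2 * \<theta> * r \<le> t * (\<kappa> * real n) + Phi (a * r * t) / t"
      using saddle_exponent_ge[OF q, of r t] r(1) tpos
      by (simp add: T_def[symmetric] \<theta>_def[symmetric] A_def[symmetric] \<kappa>_def a_def r(2))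
    have log_genfun: "Phi (a * r * t) / t - real n powr \<rho> \<le> log_genfun k t"
    proof -
      have "1 / t \<le> 8 / c * sqrt (real m)"
        using t(1) tpos c mpos by (simp add: field_simps)
      also have "\<dots> \<le> 8 / c * r" using sm c by (intro mult_left_mono) auto
      finally have "ln (1 + 1 / t) \<le> ln (1 + 8 / c * sqrt (real n))"
        using tpos c by (intro ln_mono) (auto simp: r_def add_pos_nonneg intro!: add_pos_pos)
      then have "Li2 1 + ln (1 + 1 / t) \<le> real n powr \<rho>" using e3 by (simp add: L1_def)
      moreover have "Phi (a * r * t) / t \<le> Phi (real k * t) / t"
        using tpos ar k by (intro divide_right_mono Phi_mono mult_right_mono) auto
      ultimately show ?thesis using log_genfun_lower[OF tpos kpos] by linarith
    qed
    have err: "t * (D1 * real n powr ((1 + \<beta>) / 2)) \<le> D2 * real n powr \<rho>"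
    proof -
      have "sqrt (\<kappa> / 2) * r \<le> sqrt (real m)"
        unfolding r_def using mlow' by (simp flip: real_sqrt_mult)
      then have "4 / sqrt (real m) \<le> 4 / (sqrt (\<kappa> / 2) * r)"
        using \<kappa> r(1) mpos by (intro divide_left_mono) auto
      then have "t \<le> 4 / (sqrt (\<kappa> / 2) * r)" using t(2) by linarith
      then have "t * (D1 * real n powr ((1 + \<beta>) / 2)) \<le> 4 / (sqrt (\<kappa> / 2) * r) * (D1 * real n powr ((1 + \<beta>) / 2))"
        using D1 by (intro mult_right_mono) auto
      also have "\<dots> = D2 * real n powr (\<beta> / 2)"
        unfolding split D2_def using r(1) by simp
      also have "\<dots> \<le> D2 * real n powr \<rho>" using D2 n \<rho> by (intro mult_left_mono powr_mono) auto
      finally show ?thesis .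
    qed
    have "t * (\<kappa> * real n) - D2 * real n powr \<rho> \<le> t * real m"
    proof -
      have "t * (\<kappa> * real n - D1 * real n powr ((1 + \<beta>) / 2)) \<le> t * real m"
        using tpos mwk m by (intro mult_left_mono) auto
      then show ?thesis using err by (simp add: right_diff_distrib)
    qed
    moreover have "C' * real m powr \<rho> \<le> C' * real n powr \<rho>"
      using C' m \<rho> by (intro mult_left_mono powr_mono2) auto
    ultimately have "2 * \<theta> * r - (D2 + 1 + C') * real n powr \<rho> \<le> t * real m + log_genfun k t - C' * real m powr \<rho>"
      using main log_genfun unfolding distrib_right by linarith
    then have "exp (2 * \<theta> * r - (D2 + 1 + C') * real n powr \<rho>) \<le> exp (t * real m + log_genfun k t - C' * real m powr \<rho>)"
      by simp
    with t(3) have "exp (2 * \<theta> * r - (D2 + 1 + C') * real n powr \<rho>) \<le> real (pcount k m)" by linarith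
    then show "\<exists>k. min_weight qs k \<le> n \<and>
       exp (2 * \<theta> * sqrt (real n) - (D2 + 1 + C') * real n powr \<rho>) \<le> real (pcount k (n - min_weight qs k))"
      using mwn unfolding r_def m_def by blast
  qed
  moreover have "D2 + 1 + C' \<ge> 0" using D2 C' by simp
  ultimately show ?thesis unfolding \<theta>_def by blast
qed

text \<open>
  A gap partition of \<open>n\<close> has \<open>O(sqrt n)\<close> parts, because \<^const>\<open>min_weight\<close> grows quadratically. This turns
  the error \<open>t * k powr (1 + \<beta>)\<close> into \<open>O(n powr (\<beta> / 2))\<close>.
\<close>

lemma gap_upper_positive:
  fixes q \<beta> \<rho> C :: real
  assumes q: "q > 0" and \<beta>: "0 \<le> \<beta>" "\<beta> < 1" and \<rho>: "\<beta> / 2 \<le> \<rho>" and C: "C \<ge> 0"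
    and mw: "\<And>k. \<bar>real (min_weight qs k) - q * (real k)\<^sup>2 / 2\<bar> \<le> C * real k powr (1 + \<beta>)"
  shows "\<exists>D\<ge>0. \<forall>n k. n > 0 \<and> k > 0 \<and> min_weight qs k \<le> n \<longrightarrow>
     real (pcount k (n - min_weight qs k)) \<le>
       exp (2 * theta_const q * sqrt (real n)
         - q * theta_const q / 2 * (real k - T_const q * sqrt (real n) / theta_const q)\<^sup>2 / sqrt (real n)
         + D * real n powr \<rho>)"
proof -
  define \<theta> where "\<theta> = theta_const q"
  have th: "\<theta> > 0" using theta_const[OF q] by (simp add: \<theta>_def)
  have "\<forall>\<^sub>F k in sequentially. (C + 1) * real k powr (1 + \<beta>) \<le> q / 4 * (real k)\<^sup>2"
    using q \<beta> C by real_asymp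
  then obtain K where K: "\<And>k. k \<ge> K \<Longrightarrow> (C + 1) * real k powr (1 + \<beta>) \<le> q / 4 * (real k)\<^sup>2"
    by (auto simp: eventually_sequentially)
  define b where "b = real K + 2 / sqrt q"
  have b: "b > 0" using q by (simp add: b_def add_nonneg_pos)
  have kb: "real k \<le> b * sqrt (real n)" if "n > 0" "min_weight qs k \<le> n" for k n
  proof (cases "k \<ge> K")
    case False
    then have "real k \<le> real K * 1" by simp
    also have "\<dots> \<le> real K * sqrt (real n)" using that by (intro mult_left_mono) auto
    also have "\<dots> \<le> b * sqrt (real n)" using q by (intro mult_right_mono) (auto simp: b_def)
    finally show ?thesis .
  next
    case True
    have "C * real k powr (1 + \<beta>) \<le> (C + 1) * real k powr (1 + \<beta>)" by (intro mult_right_mono) auto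
    then have "q / 4 * (real k)\<^sup>2 \<le> real (min_weight qs k)" using K[OF True] mw[of k] by linarith
    also have "\<dots> \<le> real n" using that by simp
    finally have "(real k)\<^sup>2 \<le> 4 / q * real n" using q by (simp add: field_simps)
    then have "real k \<le> sqrt (4 / q * real n)" by (rule real_le_rsqrt)
    also have "\<dots> = 2 / sqrt q * sqrt (real n)" by (simp add: real_sqrt_mult real_sqrt_divide)
    also have "\<dots> \<le> b * sqrt (real n)" by (intro mult_right_mono) (auto simp: b_def)
    finally show ?thesis .
  qed
  define D where "D = \<theta> * C * b powr (1 + \<beta>)"
  have "real (pcount k (n - min_weight qs k)) \<le>
       exp (2 * \<theta> * sqrt (real n) - q * \<theta> / 2 * (real k - T_const q * sqrt (real n) / \<theta>)\<^sup>2 / sqrt (real n)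
         + D * real n powr \<rho>)" (is "_ \<le> exp (?S + _)")
    if n: "n > 0" and k: "k > 0" and mwn: "min_weight qs k \<le> n" for n k
  proof -
    define r where "r = sqrt (real n)"
    have r: "r > 0" "r\<^sup>2 = real n" "r = real n powr (1/2)" using n by (auto simp: r_def powr_half_sqrt)
    define t where "t = \<theta> / r"
    have t: "t > 0" using th r by (simp add: t_def)
    have "real (pcount k (n - min_weight qs k)) \<le> exp (t * real (n - min_weight qs k) + Phi (real k * t) / t)"
      using t k by (rule pcount_upper_Phi)
    also have "\<dots> \<le> exp (?S + D * real n powr \<rho>)"
    proof (rule exp_mono)
      have "t * real (n - min_weight qs k) \<le> t * ((r\<^sup>2 - q * (real k)\<^sup>2 / 2) + C * real k powr (1 + \<beta>))"
        using mw[of k] mwn t by (intro mult_left_mono) (auto simp: r(2) of_nat_diff)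
      moreover have "t * (r\<^sup>2 - q * (real k)\<^sup>2 / 2) + Phi (real k * t) / t \<le> ?S"
        using saddle_exponent_le[OF q, of r "real k"] r(1) k
        by (simp add: t_def \<theta>_def r_def)
      moreover have "t * (C * real k powr (1 + \<beta>)) \<le> D * real n powr \<rho>"
      proof -
        have "t * (C * real k powr (1 + \<beta>)) \<le> t * (C * (b * r) powr (1 + \<beta>))"
          using kb[OF n mwn] t C \<beta> by (intro mult_left_mono powr_mono2) (auto simp: r_def)
        also have "(b * r) powr (1 + \<beta>) = b powr (1 + \<beta>) * (r * real n powr (\<beta> / 2))"
        proof -
          have "r powr (1 + \<beta>) = real n powr (1/2 + \<beta> / 2)"
            unfolding r(3) by (simp add: powr_powr add_divide_distrib)
          also have "\<dots> = r * real n powr (\<beta> / 2)" unfolding r(3) by (rule powr_add)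
          finally show ?thesis using b r by (simp add: powr_mult)
        qed
        also have "t * (C * (b powr (1 + \<beta>) * (r * real n powr (\<beta> / 2)))) = D * real n powr (\<beta> / 2)"
          using r by (simp add: t_def D_def)
        also have "\<dots> \<le> D * real n powr \<rho>"
          using n \<rho> th C by (intro mult_left_mono powr_mono) (auto simp: D_def)
        finally show ?thesis .
      qed
      ultimately show "t * real (n - min_weight qs k) + Phi (real k * t) / t \<le> ?S + D * real n powr \<rho>"
        unfolding distrib_left by linarith
    qed
    finally show ?thesis .
  qed
  moreover have "D \<ge> 0" using th C by (simp add: D_def)
  ultimately show ?thesis unfolding \<theta>_def by blast
qed

section \<open>The exponent for vanishing mean gap\<close>

text \<open>
  The number of parts is taken slightly above \<open>sqrt n\<close>, namely \<open>n powr (1/2 + \<epsilon>)\<close> rounded down. Then \<open>k t\<close>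
  is at least a power of \<open>n\<close>, which makes \<open>P - Phi (k t)\<close> negligible, whereas the minimal weight still costs
  less than \<open>n powr \<rho>\<close> in the exponent.
\<close>

lemma gap_lower_zero:
  fixes \<beta> \<rho> C P :: real
  assumes \<beta>: "0 \<le> \<beta>" "\<beta> < 1" and \<rho>: "\<beta> / 2 < \<rho>" "\<rho> < 1/2" and C: "C \<ge> 0"
    and mw: "\<And>k. real (min_weight qs k) \<le> C * real k powr (1 + \<beta>)"
    and P: "P > 0" "\<And>x. x \<ge> 1 \<Longrightarrow> P \<le> Phi x + 2 * exp (- x)"
  shows "\<exists>D\<ge>0. \<forall>\<^sub>F n in sequentially. \<exists>k. min_weight qs k \<le> n \<and>
     exp (2 * sqrt P * sqrt (real n) - D * real n powr \<rho>) \<le> real (pcount k (n - min_weight qs k))"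
proof -
  have \<rho>0: "\<rho> > 0" using \<beta> \<rho> by linarith
  \<comment> \<open>Chosen such that \<open>(1/2 + \<epsilon>) * (1 + \<beta>) \<le> 1/2 + \<rho>\<close>, which bounds \<open>min_weight qs k\<close> by a multiple of
    \<open>n powr (1/2 + \<rho>)\<close>, and such that \<open>\<epsilon> < \<rho> / 2\<close>, which keeps \<open>k\<close> in the range of \<open>pcount_lower_bound\<close>.\<close>
  define \<epsilon> where "\<epsilon> = (\<rho> - \<beta> / 2) / 4"
  have \<epsilon>: "\<epsilon> > 0" "\<epsilon> < \<rho> / 2" using \<rho> \<beta> by (auto simp: \<epsilon>_def)
  have "\<beta> * \<epsilon> \<le> 1 * \<epsilon>" using \<beta> \<epsilon> by (intro mult_right_mono) auto
  then have \<beta>\<epsilon>: "(1/2 + \<epsilon>) * (1 + \<beta>) \<le> 1/2 + \<rho>"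
  proof -
    have "(1/2 + \<epsilon>) * (1 + \<beta>) = 1/2 + \<beta> / 2 + \<epsilon> + \<beta> * \<epsilon>" by (simp add: field_simps)
    moreover have "4 * \<epsilon> = \<rho> - \<beta> / 2" by (simp add: \<epsilon>_def)
    ultimately show ?thesis using \<epsilon>(1) \<open>\<beta> * \<epsilon> \<le> 1 * \<epsilon>\<close> by linarith
  qed
  obtain C' where C': "C' \<ge> 0" and evm: "\<forall>\<^sub>F m in sequentially. \<forall>k. 1 * sqrt (real m) \<le> real k \<and> real k \<le> real m powr (1/2 + \<rho>/2) \<longrightarrow>
     (\<exists>t. 1 / (8 * sqrt (real m)) \<le> t \<and> t \<le> 4 / sqrt (real m) \<and>
       exp (t * real m + log_genfun k t - C' * real m powr (2 * (\<rho>/2))) \<le> real (pcount k m))"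
    using pcount_lower_bound[of 1 "\<rho>/2"] \<rho>0 by auto
  then obtain M where M: "\<And>m k. m \<ge> M \<Longrightarrow> sqrt (real m) \<le> real k \<Longrightarrow> real k \<le> real m powr (1/2 + \<rho>/2) \<Longrightarrow>
     \<exists>t. 1 / (8 * sqrt (real m)) \<le> t \<and> t \<le> 4 / sqrt (real m) \<and>
       exp (t * real m + log_genfun k t - C' * real m powr \<rho>) \<le> real (pcount k m)"
    by (auto simp: eventually_sequentially)
  define L1 where "L1 = Li2 1"
  have ev: "\<forall>\<^sub>F n in sequentially. n \<ge> 1 \<and> (C + 1) * real n powr (1/2 + \<rho>) \<le> 1 / 2 * real n
      \<and> sqrt (real n) \<le> real n powr (1/2 + \<epsilon>) - 1
      \<and> real n powr (1/2 + \<epsilon>) \<le> (1 / 2 * real n) powr (1/2 + \<rho>/2)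
      \<and> L1 + ln (1 + 8 * sqrt (real n)) + 16 * sqrt (real n) * exp (- (real n powr \<epsilon> / 16)) \<le> real n powr \<rho>
      \<and> 1 \<le> real n powr \<epsilon> / 16
      \<and> 2 \<le> real n powr (1/2 + \<epsilon>)
      \<and> real M \<le> 1 / 2 * real n"
    using \<beta> \<epsilon> \<rho> \<rho>0 C by (intro eventually_conj) real_asymp+
  define D2 where "D2 = 4 * C / sqrt (1 / 2)"
  have D2: "D2 \<ge> 0" using C by (simp add: D2_def)
  have "\<forall>\<^sub>F n in sequentially. \<exists>k. min_weight qs k \<le> n \<and>
     exp (2 * sqrt P * sqrt (real n) - (D2 + 1 + C') * real n powr \<rho>) \<le> real (pcount k (n - min_weight qs k))"
    using ev
  proof (eventually_elim, elim conjE)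
    fix n :: nat
    assume n: "n \<ge> 1"
      and e1: "(C + 1) * real n powr (1/2 + \<rho>) \<le> 1 / 2 * real n"
      and e2: "sqrt (real n) \<le> real n powr (1/2 + \<epsilon>) - 1"
      and e3: "real n powr (1/2 + \<epsilon>) \<le> (1 / 2 * real n) powr (1/2 + \<rho>/2)"
      and e4: "L1 + ln (1 + 8 * sqrt (real n)) + 16 * sqrt (real n) * exp (- (real n powr \<epsilon> / 16)) \<le> real n powr \<rho>"
      and e5: "1 \<le> real n powr \<epsilon> / 16"
      and e6: "2 \<le> real n powr (1/2 + \<epsilon>)"
      and e7: "real M \<le> 1 / 2 * real n"
    define r where "r = sqrt (real n)"
    have r: "r \<ge> 1" "r\<^sup>2 = real n" "r = real n powr (1/2)"
      using n by (auto simp: r_def powr_half_sqrt)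
    define k where "k = nat \<lfloor>real n powr (1/2 + \<epsilon>)\<rfloor>"
    have k: "real k \<le> real n powr (1/2 + \<epsilon>)" "real n powr (1/2 + \<epsilon>) - 1 \<le> real k"
      by (auto simp: k_def)
    have kpos: "k > 0" using k e6 by (cases k) auto
    have mwk: "real (min_weight qs k) \<le> C * real n powr (1/2 + \<rho>)"
    proof -
      have "real k powr (1 + \<beta>) \<le> (real n powr (1/2 + \<epsilon>)) powr (1 + \<beta>)"
        using k \<beta> by (intro powr_mono2) auto
      also have "\<dots> = real n powr ((1/2 + \<epsilon>) * (1 + \<beta>))" by (simp add: powr_powr)
      also have "\<dots> \<le> real n powr (1/2 + \<rho>)" using n \<beta>\<epsilon> by (intro powr_mono) auto
      finally have "C * real k powr (1 + \<beta>) \<le> C * real n powr (1/2 + \<rho>)" using C by (intro mult_left_mono)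
      then show ?thesis using mw[of k] by linarith
    qed
    have "C * real n powr (1/2 + \<rho>) \<le> (C + 1) * real n powr (1/2 + \<rho>)" by (intro mult_right_mono) auto
    then have mwhalf: "real (min_weight qs k) \<le> 1 / 2 * real n" using mwk e1 by linarith
    then have mwn: "min_weight qs k \<le> n" by linarith
    define m where "m = n - min_weight qs k"
    have m: "real m = real n - real (min_weight qs k)" "m \<le> n" using mwn by (auto simp: m_def of_nat_diff)
    have mlow: "1 / 2 * real n \<le> real m" using mwhalf m by simp
    have mpos: "real m > 0" using mlow n by linarith
    have "m \<ge> M" using e7 mlow by linarith
    moreover have sm: "sqrt (real m) \<le> r" unfolding r_def using m by simp
    have "sqrt (real m) \<le> real k" using sm k(2) e2 unfolding r_def by linarith
    moreover have "real k \<le> real m powr (1/2 + \<rho>/2)"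
    proof -
      have "real k \<le> (1 / 2 * real n) powr (1/2 + \<rho>/2)" using k e3 by linarith
      also have "\<dots> \<le> real m powr (1/2 + \<rho>/2)" using mlow \<rho>0 by (intro powr_mono2) auto
      finally show ?thesis .
    qed
    ultimately obtain t where t: "1 / (8 * sqrt (real m)) \<le> t" "t \<le> 4 / sqrt (real m)"
      "exp (t * real m + log_genfun k t - C' * real m powr \<rho>) \<le> real (pcount k m)" using M by blast
    have tpos: "t > 0"
    proof -
      have "0 < 1 / (8 * sqrt (real m))" using mpos by simp
      then show ?thesis using t(1) by linarith
    qed
    have it: "1 / t \<le> 8 * r"
    proof -
      have "1 / t \<le> 8 * sqrt (real m)" using t(1) tpos mpos by (simp add: field_simps)
      then show ?thesis using sm by linarith
    qed
    have kt: "real n powr \<epsilon> / 16 \<le> real k * t"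
    proof -
      have "real n powr (1/2 + \<epsilon>) / 2 \<le> real k" using k e6 by linarith
      moreover have "1 / (8 * r) \<le> t" using it tpos r(1) by (simp add: field_simps)
      ultimately have "real n powr (1/2 + \<epsilon>) / 2 * (1 / (8 * r)) \<le> real k * t"
        using r by (intro mult_mono) auto
      moreover have "real n powr (1/2 + \<epsilon>) = r * real n powr \<epsilon>" unfolding r(3) by (rule powr_add)
      then have "real n powr (1/2 + \<epsilon>) / 2 * (1 / (8 * r)) = real n powr \<epsilon> / 16" using r(1) by simp
      ultimately show ?thesis by linarith
    qed
    have log_genfun: "P / t - real n powr \<rho> \<le> log_genfun k t"
    proof -
      have "1 \<le> real k * t" using kt e5 by linarith
      then have "P \<le> Phi (real k * t) + 2 * exp (- (real k * t))" by (rule P(2))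
      also have "\<dots> \<le> Phi (real k * t) + 2 * exp (- (real n powr \<epsilon> / 16))" using kt by simp
      finally have "P / t \<le> (Phi (real k * t) + 2 * exp (- (real n powr \<epsilon> / 16))) / t"
        using tpos by (intro divide_right_mono) auto
      also have "\<dots> = Phi (real k * t) / t + 2 * exp (- (real n powr \<epsilon> / 16)) * (1 / t)"
        by (simp add: add_divide_distrib)
      also have "\<dots> \<le> Phi (real k * t) / t + 2 * exp (- (real n powr \<epsilon> / 16)) * (8 * r)"
        using it by (intro add_mono mult_left_mono) auto
      finally have "P / t \<le> Phi (real k * t) / t + 16 * r * exp (- (real n powr \<epsilon> / 16))"
        by (simp add: mult_ac)
      moreover have "ln (1 + 1 / t) \<le> ln (1 + 8 * r)"
        using it tpos by (intro ln_mono) (auto intro!: add_pos_pos)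
      ultimately show ?thesis using log_genfun_lower[OF tpos kpos] e4 unfolding L1_def r_def by linarith
    qed
    have amgm: "2 * sqrt P * r \<le> t * real n + P / t"
    proof -
      have "0 \<le> (t * r - sqrt P)\<^sup>2" by simp
      also have "\<dots> = t * (t * real n) + P - t * (2 * sqrt P * r)"
        using P(1) r(2) by (simp add: power2_eq_square algebra_simps)
      finally have "t * (2 * sqrt P * r) \<le> t * (t * real n + P / t)"
        using tpos by (simp add: distrib_left)
      then show ?thesis using tpos by (simp only: mult_le_cancel_left_pos)
    qed
    have err: "t * (C * real n powr (1/2 + \<rho>)) \<le> D2 * real n powr \<rho>"
    proof -
      have "sqrt (1 / 2) * r \<le> sqrt (real m)"
        unfolding r_def using mlow by (simp flip: real_sqrt_mult del: real_sqrt_divide)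
      then have "4 / sqrt (real m) \<le> 4 / (sqrt (1 / 2) * r)"
        using r(1) mpos by (intro divide_left_mono) auto
      then have "t \<le> 4 / (sqrt (1 / 2) * r)" using t(2) by linarith
      then have "t * (C * real n powr (1/2 + \<rho>)) \<le> 4 / (sqrt (1 / 2) * r) * (C * real n powr (1/2 + \<rho>))"
        using C by (intro mult_right_mono) auto
      also have "\<dots> = D2 * real n powr \<rho>"
      proof -
        have split: "real n powr (1/2 + \<rho>) = r * real n powr \<rho>" unfolding r(3) by (rule powr_add)
        show ?thesis unfolding split D2_def using r(1) by simp
      qed
      finally show ?thesis .
    qed
    have "t * real n - D2 * real n powr \<rho> \<le> t * real m"
    proof -
      have "t * (real n - C * real n powr (1/2 + \<rho>)) \<le> t * real m"
        using tpos mwk m by (intro mult_left_mono) auto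
      then show ?thesis using err by (simp add: right_diff_distrib)
    qed
    moreover have "C' * real m powr \<rho> \<le> C' * real n powr \<rho>"
      using C' m \<rho>0 by (intro mult_left_mono powr_mono2) auto
    ultimately have "2 * sqrt P * r - (D2 + 1 + C') * real n powr \<rho> \<le> t * real m + log_genfun k t - C' * real m powr \<rho>"
      using amgm log_genfun unfolding distrib_right by linarith
    then have "exp (2 * sqrt P * r - (D2 + 1 + C') * real n powr \<rho>) \<le> exp (t * real m + log_genfun k t - C' * real m powr \<rho>)"
      by simp
    with t(3) have "exp (2 * sqrt P * r - (D2 + 1 + C') * real n powr \<rho>) \<le> real (pcount k m)" by linarith
    then show "\<exists>k. min_weight qs k \<le> n \<and>
       exp (2 * sqrt P * sqrt (real n) - (D2 + 1 + C') * real n powr \<rho>) \<le> real (pcount k (n - min_weight qs k))"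
      using mwn unfolding r_def m_def by blast
  qed
  moreover have "D2 + 1 + C' \<ge> 0" using D2 C' by simp
  ultimately show ?thesis by blast
qed

lemma gap_upper_zero:
  fixes P \<gamma> :: real
  assumes qs: "gap_sequence qs" and \<gamma>: "\<gamma> > 0"
    and P: "P > 0" "\<And>x. x > 0 \<Longrightarrow> Phi x + exp (- x) \<le> P"
  shows "\<forall>\<^sub>F n in sequentially. \<forall>k. k > 0 \<and> min_weight qs k \<le> n \<and>
       (real k < 1/2 * sqrt (real n) * ln (ln (real n)) \<or> real k > real n powr (1 - \<gamma>)) \<longrightarrow>
     real (pcount k (n - min_weight qs k)) \<le> exp (2 * sqrt P * sqrt (real n) - sqrt P * real n powr (1/2 - \<gamma>))"
proof -
  define c where "c = sqrt P"
  have c: "c > 0" "c * c = P" using P by (auto simp: c_def)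
  have "\<forall>\<^sub>F n in sequentially. n \<ge> 1 \<and>
     c * real n powr (1/2 - \<gamma>) \<le> sqrt (real n) / c * exp (- (c / 2 * ln (ln (real n))))"
    using c \<gamma> by (intro eventually_conj) real_asymp+
  then show ?thesis
  proof (eventually_elim, intro allI impI, elim conjE)
    fix n k :: nat
    assume n: "1 \<le> n"
      and ev: "c * real n powr (1/2 - \<gamma>) \<le> sqrt (real n) / c * exp (- (c / 2 * ln (ln (real n))))"
      and k: "k > 0" and mwn: "min_weight qs k \<le> n"
      and bad: "real k < 1/2 * sqrt (real n) * ln (ln (real n)) \<or> real k > real n powr (1 - \<gamma>)"
    define r where "r = sqrt (real n)"
    have r: "r > 0" "r\<^sup>2 = real n" "r = real n powr (1/2)" using n by (auto simp: r_def powr_half_sqrt)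
    define t where "t = c / r"
    have t: "t > 0" using c r by (simp add: t_def)
    have tn: "t * real n = c * r" unfolding r(2)[symmetric] using r(1) by (simp add: t_def power2_eq_square)
    have Pt: "P / t = c * r" using c r by (simp add: t_def flip: c(2))
    have kt: "real k * t > 0" using k t by simp
    have "real (pcount k (n - min_weight qs k)) \<le> exp (t * real (n - min_weight qs k) + Phi (real k * t) / t)"
      using t k by (rule pcount_upper_Phi)
    also have "\<dots> \<le> exp (2 * c * r - c * real n powr (1/2 - \<gamma>))"
    proof (rule exp_mono)
      have "Phi (real k * t) / t \<le> (P - exp (- (real k * t))) / t"
        using P(2)[OF kt] t by (intro divide_right_mono) auto
      then have Ph: "Phi (real k * t) / t \<le> c * r - r / c * exp (- (real k * t))"
        by (simp add: diff_divide_distrib Pt) (simp add: t_def mult_ac)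
      show "t * real (n - min_weight qs k) + Phi (real k * t) / t \<le> 2 * c * r - c * real n powr (1/2 - \<gamma>)"
      proof (cases "real k > real n powr (1 - \<gamma>)")
        case True
        have "real n powr (1 - \<gamma>) \<le> real (min_weight qs k)"
          using le_min_weight[OF qs, of k] True by linarith
        then have "t * real (n - min_weight qs k) \<le> t * (real n - real n powr (1 - \<gamma>))"
          using t mwn by (intro mult_left_mono) (auto simp: of_nat_diff)
        also have "\<dots> = c * r - c * real n powr (1/2 - \<gamma>)"
        proof -
          have "real n powr (1 - \<gamma>) = r * real n powr (1/2 - \<gamma>)"
            unfolding r(3) by (simp flip: powr_add)
          then show ?thesis using r by (simp add: right_diff_distrib tn) (simp add: t_def)
        qed
        finally have "t * real (n - min_weight qs k) \<le> c * r - c * real n powr (1/2 - \<gamma>)" .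
        moreover have "r / c * exp (- (real k * t)) \<ge> 0" using r c by simp
        ultimately show ?thesis using Ph by linarith
      next
        case False
        then have "real k < 1/2 * r * ln (ln (real n))" using bad by (simp add: r_def)
        then have "real k * t \<le> 1/2 * r * ln (ln (real n)) * t" using t by (intro mult_right_mono) auto
        also have "\<dots> = c / 2 * ln (ln (real n))" using r by (simp add: t_def)
        finally have "r / c * exp (- (c / 2 * ln (ln (real n)))) \<le> r / c * exp (- (real k * t))"
          using r c by (intro mult_left_mono) auto
        moreover have "t * real (n - min_weight qs k) \<le> t * real n" using t by (intro mult_left_mono) auto
        ultimately show ?thesis using Ph ev tn unfolding r_def by linarith
      qed
    qed
    finally show "real (pcount k (n - min_weight qs k)) \<le>
      exp (2 * sqrt P * sqrt (real n) - sqrt P * real n powr (1/2 - \<gamma>))"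
      by (simp add: c_def r_def)
  qed
qed

section \<open>Concentration of the number of parts\<close>

lemma num_parts_concentration_positive:
  fixes qs :: "nat \<Rightarrow> nat" and q \<beta> \<gamma> C a :: real
  assumes qs: "gap_sequence qs" and q: "q > 0" and \<beta>: "0 \<le> \<beta>" "\<beta> < 1"
    and \<gamma>: "0 < \<gamma>" "\<gamma> < (1 - \<beta>) / 2" and C: "C \<ge> 0"
    and mw: "\<And>k. \<bar>real (min_weight qs k) - q * (real k)\<^sup>2 / 2\<bar> \<le> C * real k powr (1 + \<beta>)"
    and a: "a > 0"
  shows "limsup (\<lambda>n. ereal (real n powr (- (1/2 - \<gamma>))) *
      ext_ln (measure_pmf.prob (gap_measure qs n) {l \<in> gap_partitions_of qs n.
        \<bar>real (num_parts l) - real (nat \<lceil>T_const q * sqrt (real n) / theta_const q\<rceil>)\<bar>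
          > a * real n powr ((1 - \<gamma>) / 2)})) < 0"
proof -
  define \<theta> T where "\<theta> = theta_const q" and "T = T_const q"
  have th: "\<theta> > 0" using theta_const[OF q] by (simp add: \<theta>_def)
  have T: "T > 0" using T_const_properties[OF q] by (simp add: T_def)
  \<comment> \<open>Any exponent strictly between those of the error and of the gain would do.\<close>
  define \<rho> where "\<rho> = (\<beta> / 2 + (1/2 - \<gamma>)) / 2"
  have \<rho>: "0 < \<rho>" "\<beta> / 2 \<le> \<rho>" "\<rho> < 1/2 - \<gamma>" using \<beta> \<gamma> by (auto simp: \<rho>_def field_simps)
  define c where "c = q * \<theta> / 2 * (a / 2)\<^sup>2"
  have c: "c > 0" using q th a by (simp add: c_def)
  obtain D1 where D1: "D1 \<ge> 0" "\<forall>\<^sub>F n in sequentially. \<exists>k. min_weight qs k \<le> n \<and>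
     exp (2 * \<theta> * sqrt (real n) - D1 * real n powr \<rho>) \<le> real (pcount k (n - min_weight qs k))"
    using gap_lower_positive[OF q \<beta> \<rho>(1,2) C mw] unfolding \<theta>_def by blast
  obtain D2 where D2: "D2 \<ge> 0" "\<And>n k. n > 0 \<Longrightarrow> k > 0 \<Longrightarrow> min_weight qs k \<le> n \<Longrightarrow>
     real (pcount k (n - min_weight qs k)) \<le>
       exp (2 * \<theta> * sqrt (real n) - q * \<theta> / 2 * (real k - T * sqrt (real n) / \<theta>)\<^sup>2 / sqrt (real n)
         + D2 * real n powr \<rho>)"
    using gap_upper_positive[OF q \<beta> \<rho>(2) C mw] unfolding \<theta>_def T_def by blast
  define D where "D = max D1 D2"
  have D: "D \<ge> 0" "D1 \<le> D" "D2 \<le> D" using D1 by (auto simp: D_def)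
  define Bad where "Bad = (\<lambda>n k. \<bar>real k - real (nat \<lceil>T * sqrt (real n) / \<theta>\<rceil>)\<bar> > a * real n powr ((1 - \<gamma>) / 2))"
  have "limsup (\<lambda>n. ereal (real n powr (- (1/2 - \<gamma>))) *
      ext_ln (measure_pmf.prob (gap_measure qs n) {l \<in> gap_partitions_of qs n. Bad n (num_parts l)})) < 0"
  proof (rule gap_limsup_neg[OF qs c D(1) \<rho>(1,3)])
    show "\<forall>\<^sub>F n in sequentially. \<exists>k. min_weight qs k \<le> n \<and>
        exp (2 * \<theta> * sqrt (real n) - D * real n powr \<rho>) \<le> real (pcount k (n - min_weight qs k))"
      using D1(2)
    proof eventually_elim
      case (elim n)
      have "D1 * real n powr \<rho> \<le> D * real n powr \<rho>" using D by (intro mult_right_mono) auto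
      then have "exp (2 * \<theta> * sqrt (real n) - D * real n powr \<rho>) \<le> exp (2 * \<theta> * sqrt (real n) - D1 * real n powr \<rho>)"
        by simp
      with elim show ?case by (meson order_trans)
    qed
    have "\<forall>\<^sub>F n in sequentially. 1 \<le> a / 2 * real n powr ((1 - \<gamma>) / 2)"
      using a \<gamma> \<beta> by real_asymp
    then show "\<forall>\<^sub>F n in sequentially. \<forall>k. k > 0 \<and> min_weight qs k \<le> n \<and> Bad n k \<longrightarrow>
        real (pcount k (n - min_weight qs k)) \<le>
          exp (2 * \<theta> * sqrt (real n) - c * real n powr (1/2 - \<gamma>) + D * real n powr \<rho>)"
      using eventually_gt_at_top[of 0]
    proof (eventually_elim, intro allI impI, elim conjE)
      fix n k :: nat
      assume ev: "1 \<le> a / 2 * real n powr ((1 - \<gamma>) / 2)" and n: "0 < n"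
        and k: "k > 0" "min_weight qs k \<le> n" and bad: "Bad n k"
      define s where "s = T * sqrt (real n) / \<theta>"
      define d where "d = real k - s"
      have "s > 0" using T th n by (simp add: s_def)
      then have "\<bar>real (nat \<lceil>s\<rceil>) - s\<bar> \<le> 1" by (simp add: abs_le_iff) linarith
      moreover have "\<bar>real k - real (nat \<lceil>s\<rceil>)\<bar> > a * real n powr ((1 - \<gamma>) / 2)"
        using bad by (simp add: Bad_def s_def)
      ultimately have "a / 2 * real n powr ((1 - \<gamma>) / 2) \<le> \<bar>d\<bar>" using ev unfolding d_def by linarith
      then have "(a / 2 * real n powr ((1 - \<gamma>) / 2))\<^sup>2 \<le> \<bar>d\<bar>\<^sup>2" using a by (intro power_mono) auto
      then have "(a / 2)\<^sup>2 * real n powr (1 - \<gamma>) \<le> d\<^sup>2"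
        by (simp only: power_mult_distrib power2_abs) (simp add: power2_eq_square flip: powr_add)
      then have "(a / 2)\<^sup>2 * real n powr (1 - \<gamma>) / sqrt (real n) \<le> d\<^sup>2 / sqrt (real n)"
        by (intro divide_right_mono) auto
      moreover have "real n powr (1 - \<gamma>) / sqrt (real n) = real n powr (1/2 - \<gamma>)"
        using n by (simp add: powr_half_sqrt[symmetric] flip: powr_diff)
      ultimately have "(a / 2)\<^sup>2 * real n powr (1/2 - \<gamma>) \<le> d\<^sup>2 / sqrt (real n)"
        by (metis times_divide_eq_right)
      then have "q * \<theta> / 2 * ((a / 2)\<^sup>2 * real n powr (1/2 - \<gamma>)) \<le> q * \<theta> / 2 * (d\<^sup>2 / sqrt (real n))"
        using q th by (intro mult_left_mono) auto
      then have "c * real n powr (1/2 - \<gamma>) \<le> q * \<theta> / 2 * d\<^sup>2 / sqrt (real n)" by (simp add: c_def)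
      moreover have "D2 * real n powr \<rho> \<le> D * real n powr \<rho>" using D by (intro mult_right_mono) auto
      ultimately have "exp (2 * \<theta> * sqrt (real n) - q * \<theta> / 2 * d\<^sup>2 / sqrt (real n) + D2 * real n powr \<rho>)
          \<le> exp (2 * \<theta> * sqrt (real n) - c * real n powr (1/2 - \<gamma>) + D * real n powr \<rho>)"
        by simp
      with D2(2)[OF n k] show "real (pcount k (n - min_weight qs k)) \<le>
          exp (2 * \<theta> * sqrt (real n) - c * real n powr (1/2 - \<gamma>) + D * real n powr \<rho>)"
        unfolding d_def s_def by linarith
    qed
  qed
  then show ?thesis by (simp add: Bad_def \<theta>_def T_def)
qed

lemma num_parts_concentration_zero:
  fixes qs :: "nat \<Rightarrow> nat" and \<beta> \<gamma> C :: real
  assumes qs: "gap_sequence qs" and \<beta>: "0 \<le> \<beta>" "\<beta> < 1"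
    and \<gamma>: "0 < \<gamma>" "\<gamma> < (1 - \<beta>) / 2" and C: "C \<ge> 0"
    and mw: "\<And>k. real (min_weight qs k) \<le> C * real k powr (1 + \<beta>)"
  shows "limsup (\<lambda>n. ereal (real n powr (- (1/2 - \<gamma>))) *
      ext_ln (measure_pmf.prob (gap_measure qs n) {l \<in> gap_partitions_of qs n.
        real (num_parts l) < 1/2 * sqrt (real n) * ln (ln (real n)) \<or>
        real (num_parts l) > real n powr (1 - \<gamma>)})) < 0"
proof -
  define \<rho> where "\<rho> = (\<beta> / 2 + (1/2 - \<gamma>)) / 2"
  have \<rho>: "0 < \<rho>" "\<beta> / 2 < \<rho>" "\<rho> < 1/2 - \<gamma>" using \<beta> \<gamma> by (auto simp: \<rho>_def field_simps)
  obtain P where P: "P > 0" "\<And>x. x > 0 \<Longrightarrow> Phi x + exp (- x) \<le> P"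
    "\<And>x. x \<ge> 1 \<Longrightarrow> P \<le> Phi x + 2 * exp (- x)" using Phi_limit by blast
  obtain D where D: "D \<ge> 0" "\<forall>\<^sub>F n in sequentially. \<exists>k. min_weight qs k \<le> n \<and>
     exp (2 * sqrt P * sqrt (real n) - D * real n powr \<rho>) \<le> real (pcount k (n - min_weight qs k))"
    using gap_lower_zero[OF \<beta> \<rho>(2) _ C mw P(1,3)] \<rho>(3) \<gamma> by auto
  show ?thesis
  proof (rule gap_limsup_neg[OF qs _ D(1) \<rho>(1,3) D(2)])
    show "sqrt P > 0" using P by simp
    have "\<forall>\<^sub>F n in sequentially. \<forall>k. k > 0 \<and> min_weight qs k \<le> n \<and>
       (real k < 1/2 * sqrt (real n) * ln (ln (real n)) \<or> real k > real n powr (1 - \<gamma>)) \<longrightarrow>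
     real (pcount k (n - min_weight qs k)) \<le> exp (2 * sqrt P * sqrt (real n) - sqrt P * real n powr (1/2 - \<gamma>))"
      by (rule gap_upper_zero) (use qs \<gamma> P in auto)
    then show "\<forall>\<^sub>F n in sequentially. \<forall>k. k > 0 \<and> min_weight qs k \<le> n \<and>
       (real k < 1/2 * sqrt (real n) * ln (ln (real n)) \<or> real k > real n powr (1 - \<gamma>)) \<longrightarrow>
       real (pcount k (n - min_weight qs k)) \<le>
         exp (2 * sqrt P * sqrt (real n) - sqrt P * real n powr (1/2 - \<gamma>) + D * real n powr \<rho>)"
    proof eventually_elim
      case (elim n)
      have "exp (2 * sqrt P * sqrt (real n) - sqrt P * real n powr (1/2 - \<gamma>))
          \<le> exp (2 * sqrt P * sqrt (real n) - sqrt P * real n powr (1/2 - \<gamma>) + D * real n powr \<rho>)"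
        using D(1) by simp
      with elim show ?case by (meson order_trans)
    qed
  qed
qed

lemma ceiling_sqrt_asymp_equiv:
  fixes a :: real
  assumes "a > 0"
  shows "(\<lambda>n. real (nat \<lceil>a * sqrt (real n)\<rceil>)) \<sim>[sequentially] (\<lambda>n. a * sqrt (real n))"
proof -
  have "(\<lambda>n. real (nat \<lceil>a * sqrt (real n)\<rceil>)) = (\<lambda>n. real_of_int \<lceil>a * sqrt (real n)\<rceil>)"
    using assms by (auto intro!: of_nat_nat)
  moreover have "(\<lambda>n. real_of_int \<lceil>a * sqrt (real n)\<rceil>) \<sim>[sequentially] (\<lambda>n. a * sqrt (real n))"
    using assms by real_asymp
  ultimately show ?thesis by simp
qed

theorem theorem3p8:
  fixes qs :: "nat \<Rightarrow> nat" and q \<beta> \<gamma> :: real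
  assumes "gap_sequence qs"
    and "q \<ge> 0" and "0 \<le> \<beta>" and "\<beta> < 1"
    and "(\<lambda>k. real (\<Sum>i<k. qs i) - q * real k) \<in> O(\<lambda>k. real k powr \<beta>)"
    and "0 < \<gamma>" and "\<gamma> < (1 - \<beta>) / 2"
  shows
    "(q > 0 \<longrightarrow>
       (\<exists>k :: nat \<Rightarrow> nat.
          (\<lambda>n. real (k n)) \<sim>[sequentially] (\<lambda>n. T_const q * sqrt (real n) / theta_const q) \<and>
          (\<forall>a::real. a > 0 \<longrightarrow>
             limsup (\<lambda>n. ereal (real n powr (\<gamma> - 1/2)) *
               ext_ln (measure_pmf.prob (gap_measure qs n)
                 {l \<in> gap_partitions_of qs n.
                    \<bar>real (num_parts l) - real (k n)\<bar> > a * real n powr ((1 - \<gamma>) / 2)})) < 0)))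
     \<and>
     (q = 0 \<longrightarrow>
        limsup (\<lambda>n. ereal (real n powr (\<gamma> - 1/2)) *
          ext_ln (measure_pmf.prob (gap_measure qs n)
            {l \<in> gap_partitions_of qs n.
               real (num_parts l) < 1/2 * sqrt (real n) * ln (ln (real n)) \<or>
               real (num_parts l) > real n powr (1 - \<gamma>)})) < 0)"
proof -
  obtain C where C: "C \<ge> 0"
    "\<And>k. \<bar>real (min_weight qs k) - q * (real k)\<^sup>2 / 2\<bar> \<le> C * real k powr (1 + \<beta>)"
    using min_weight_estimate[OF assms(2,3,5)] by blast
  have \<delta>: "\<gamma> - 1/2 = - (1/2 - \<gamma>)" by simp
  show ?thesis
    unfolding \<delta>
  proof (intro conjI impI)
    assume q: "q > 0"
    let ?k = "\<lambda>n. nat \<lceil>T_const q * sqrt (real n) / theta_const q\<rceil>"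
    have "(\<lambda>n. real (?k n)) \<sim>[sequentially] (\<lambda>n. T_const q * sqrt (real n) / theta_const q)"
      using ceiling_sqrt_asymp_equiv[of "T_const q / theta_const q"]
        T_const_properties(1)[OF q] theta_const(1)[OF q] by simp
    then show "\<exists>k :: nat \<Rightarrow> nat.
          (\<lambda>n. real (k n)) \<sim>[sequentially] (\<lambda>n. T_const q * sqrt (real n) / theta_const q) \<and>
          (\<forall>a::real. a > 0 \<longrightarrow>
             limsup (\<lambda>n. ereal (real n powr (- (1/2 - \<gamma>))) *
               ext_ln (measure_pmf.prob (gap_measure qs n)
                 {l \<in> gap_partitions_of qs n.
                    \<bar>real (num_parts l) - real (k n)\<bar> > a * real n powr ((1 - \<gamma>) / 2)})) < 0)"
      using num_parts_concentration_positive[OF assms(1) q assms(3,4,6,7) C] by (intro exI[of _ ?k]) blast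
  next
    assume q: "q = 0"
    have "real (min_weight qs k) \<le> C * real k powr (1 + \<beta>)" for k
      using C(2)[of k] q by simp
    then show "limsup (\<lambda>n. ereal (real n powr (- (1/2 - \<gamma>))) *
          ext_ln (measure_pmf.prob (gap_measure qs n)
            {l \<in> gap_partitions_of qs n.
               real (num_parts l) < 1/2 * sqrt (real n) * ln (ln (real n)) \<or>
               real (num_parts l) > real n powr (1 - \<gamma>)})) < 0"
      by (intro num_parts_concentration_zero[OF assms(1,3,4,6,7) C(1)])
  qed
qed

end
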